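(* Let $\mathbf{X}$ and $\mathbf{Y}$ be disjoint node sets in a maximal PDAG $\mathcal{G}=(\mathbf{V},\mathbf{E})$ and let $\mathbf{V}$ follow a causal linear model compatible with $\mathcal{G}$. Let $\mathbf{Z}$ be a valid adjustment set relative to $(\mathbf{X},\mathbf{Y})$ in $\mathcal{G}$. Consider the following pruning procedure: start with $\mathbf{Z}'=\mathbf{Z}$; go through the nodes $Z\in\mathbf{Z}$ one after another in some order, and for each, if $\mathbf{Y}\perp_{\mathcal{G}}Z\mid\mathbf{X}\cup(\mathbf{Z}'\setminus\{Z\})$ for the current $\mathbf{Z}'$, replace $\mathbf{Z}'$ by $\mathbf{Z}'\setminus\{Z\}$; return the final $\mathbf{Z}'$. Then: 1. The output $\mathbf{Z}'\subseteq\mathbf{Z}$ is a valid adjustment set relative to $(\mathbf{X},\mathbf{Y})$ in $\mathcal{G}$, and $a.var(\hat{\tau}^{\mathbf{z}'}_{\mathbf{yx}})\le a.var(\hat{\tau}^{\mathbf{z}}_{\mathbf{yx}})$ entrywise. 2. There is no other subset of $\mathbf{Z}$ for which the graphical comparison criterion (defined in the context) guarantees a better asymptotic variance than $\mathbf{Z}'$; that is, there is no valid adjustment set $\mathbf{Z}''\subseteq\mathbf{Z}$ relative to $(\mathbf{X},\mathbf{Y})$ in $\mathcal{G}$ such that the criterion applies to the ordered pair $(\mathbf{Z}',\mathbf{Z}'')$ but not to the ordered pair $(\mathbf{Z}'',\mathbf{Z}')$. 3. The procedure outputs the same set $\mathbf{Z}'$ regardless of the order in which the nodes of $\mathbf{Z}$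 are considered.
   Context: **Graphs.** Graphs are simple with finite node set; each edge is directed ($\to$) or undirected ($-$). A PDAG is such a graph without directed cycles; a DAG is a PDAG with only directed edges. A path is a sequence of distinct nodes in which successive nodes are adjacent; a path from a node set $\mathbf{X}$ to a node set $\mathbf{Y}$ goes from some $X\in\mathbf{X}$ to some $Y\in\mathbf{Y}$, and is proper if only its first node is in $\mathbf{X}$. A path $(V_1,\dots,V_m)$ is causal (directed) if $V_i\to V_{i+1}$ for all $i$; it is possibly causal (possibly directed) if there are no $i<j$ such that the edge $V_i\leftarrow V_j$ is in the graph; otherwise it is non-causal. $\mathrm{pa}(X,\mathcal{G})$ is the set of nodes $W$ with $W\to X$; $\mathrm{de}(X,\mathcal{G})$ (resp. $\mathrm{possde}(X,\mathcal{G})$) is the set of nodes reachable from $X$ by a directed (resp. possibly directed) path, including $X$ itself; for node sets take unions. **Maximal PDAGs.** A v-structure is $U\to V\leftarrow W$ with $U,W$ non-adjacent. A PDAG is maximal if none of these is an induced subgraph: (a) $A\to B-C$, with $A,C$ non-adjacent; (b) $A\to B\to C$, $A-C$; (c) $B\to D$, $C\to D$, $A-D$, $A-B$, $A-C$, with $B,C$ non-adjacent; (d) $B\to C\to D$, $A-B$, $A-C$, $A-D$, with $B,D$ non-adjacent. A maximal PDAG $\mathcal{G}$ represents the (non-empty) set $[\mathcal{G}]$ of DAGs that have the same adjacencies and v-structures as $\mathcal{G}$ and contain all its directed edges; for each undirected edge of $\mathcal{G}$ both orientations occur in $[\mathcal{G}]$. DAGs are special cases, with $[\mathcal{G}]=\{\mathcal{G}\}$.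 **d-separation.** A node $V$ is a collider on a path if the path contains $U\to V\leftarrow W$; a non-collider if it contains a subpath $(U,V,W)$ with $U\leftarrow V$, or $V\to W$, or $U-V-W$ with $U,W$ non-adjacent. A path is of definite status if every non-endpoint is a collider or a non-collider on it. A definite status path is blocked by a node set $\mathbf{Z}$ if it contains a non-collider in $\mathbf{Z}$ or a collider $C$ with $\mathrm{de}(C,\mathcal{G})\cap\mathbf{Z}=\emptyset$; otherwise it is open given $\mathbf{Z}$. For pairwise disjoint $\mathbf{A},\mathbf{B},\mathbf{Z}$, $\mathbf{A}\perp_{\mathcal{G}}\mathbf{B}\mid\mathbf{Z}$ means that $\mathbf{Z}$ blocks every definite status path between a node of $\mathbf{A}$ and a node of $\mathbf{B}$ (trivially true if $\mathbf{A}$ or $\mathbf{B}$ is empty). **Valid adjustment sets.** For disjoint $\mathbf{X},\mathbf{Y}$, $\mathrm{posscn}(\mathbf{X},\mathbf{Y},\mathcal{G})$ is the set of all nodes on proper possibly causal paths from $\mathbf{X}$ to $\mathbf{Y}$, excluding nodes in $\mathbf{X}$, and $\mathrm{forb}(\mathbf{X},\mathbf{Y},\mathcal{G})=\mathrm{possde}(\mathrm{posscn}(\mathbf{X},\mathbf{Y},\mathcal{G}),\mathcal{G})\cup\mathbf{X}$. A node set $\mathbf{Z}$ disjoint from $\mathbf{X}\cup\mathbf{Y}$ is a valid adjustment set relative to $(\mathbf{X},\mathbf{Y})$ in $\mathcal{G}$ if: (1) $\mathcal{G}$ is amenable relative to $(\mathbf{X},\mathbf{Y})$, i.e. every proper possibly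 causal path from $\mathbf{X}$ to $\mathbf{Y}$ starts with a directed edge out of $\mathbf{X}$; (2) $\mathbf{Z}\cap\mathrm{forb}(\mathbf{X},\mathbf{Y},\mathcal{G})=\emptyset$; (3) all proper non-causal definite status paths from $\mathbf{X}$ to $\mathbf{Y}$ are blocked by $\mathbf{Z}$. **Comparison criterion.** The criterion applies to an ordered pair $(\mathbf{Z}_1,\mathbf{Z}_2)$ of valid adjustment sets relative to $(\mathbf{X},\mathbf{Y})$ in $\mathcal{G}$ if $\mathbf{Y}\perp_{\mathcal{G}}(\mathbf{Z}_1\setminus\mathbf{Z}_2)\mid\mathbf{X}\cup\mathbf{Z}_2$ and $\mathbf{X}\perp_{\mathcal{G}}(\mathbf{Z}_2\setminus\mathbf{Z}_1)\mid\mathbf{Z}_1$; in that case it guarantees $a.var(\hat{\tau}_{\mathbf{yx}}^{\mathbf{z}_2})\le a.var(\hat{\tau}_{\mathbf{yx}}^{\mathbf{z}_1})$ entrywise. **Causal linear model.** A density $f$ of $\mathbf{V}=(V_1,\dots,V_p)$ is compatible with a causal DAG $\mathcal{D}$ if all interventional densities satisfy $f(\mathbf{v}\mid do(\mathbf{x}))=\prod_{V_i\in\mathbf{V}\setminus\mathbf{X}}f(v_i\mid\mathrm{pa}(V_i,\mathcal{D}))$ for values consistent with $\mathbf{X}=\mathbf{x}$ and $0$ otherwise. $\mathbf{V}$ follows a causal linear model compatible with a DAG $\mathcal{D}$ if its distribution is compatible with $\mathcal{D}$ and $V_i=\sum_{V_j\in\mathrm{pa}(V_i,\mathcal{D})}\alpha_{ij}V_j+\epsilon_{v_i}$,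 $i=1,\dots,p$, with $\alpha_{ij}\in\mathbb{R}$ and jointly independent errors $\epsilon_{v_i}$ of mean $0$ and finite variance (not necessarily Gaussian). It is compatible with a maximal PDAG $\mathcal{G}$ if it is compatible with some $\mathcal{D}\in[\mathcal{G}]$. The covariance matrix of $\mathbf{V}$ is assumed non-singular. **Asymptotic variance.** $\Sigma_{\mathbf{st}}$ is the covariance matrix between $\mathbf{S}$ and $\mathbf{T}$, $\Sigma_{\mathbf{ss}.\mathbf{t}}=\Sigma_{\mathbf{ss}}-\Sigma_{\mathbf{st}}\Sigma_{\mathbf{tt}}^{-1}\Sigma_{\mathbf{ts}}$, written $\sigma_{ss.\mathbf{t}}$ if $|\mathbf{S}|=1$ (juxtaposed subscripts denote unions of conditioning sets); $\mathbf{X}_{-i}=\mathbf{X}\setminus\{X_i\}$. For a valid adjustment set $\mathbf{Z}$, $\hat{\tau}^{\mathbf{z}}_{\mathbf{yx}}$ is the matrix whose $(j,i)$ entry is the least squares coefficient of $X_i$ in the regression of $Y_j$ on $\mathbf{X}$ and $\mathbf{Z}$, and $a.var(\hat{\tau}^{\mathbf{z}}_{\mathbf{yx}})$ is the matrix of its asymptotic variances, with entries $$a.var(\hat{\tau}^{\mathbf{z}}_{\mathbf{yx}})_{j,i}=\frac{\sigma_{y_jy_j.\mathbf{xz}}}{\sigma_{x_ix_i.\mathbf{x}_{-i}\mathbf{z}}}.$$ *)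

theory Defs
  imports "HOL-Probability.Probability"
begin

section \<open>Partially directed graphs\<close>

text \<open>A pair \<open>(u, v)\<close> in \<open>dir\<close> is an edge \<open>u \<rightarrow> v\<close>; an undirected edge \<open>u - v\<close> is
  stored in \<open>und\<close> as both pairs \<open>(u, v)\<close> and \<open>(v, u)\<close>.\<close>

record 'v pgraph =
  nodes :: "'v set"
  dir :: "('v \<times> 'v) set"
  und :: "('v \<times> 'v) set"

definition adj :: "'v pgraph \<Rightarrow> 'v \<Rightarrow> 'v \<Rightarrow> bool" where
  "adj G u v \<longleftrightarrow> (u, v) \<in> dir G \<or> (v, u) \<in> dir G \<or> (u, v) \<in> und G"

definition simple_graph :: "'v pgraph \<Rightarrow> bool" where
  "simple_graph G \<longleftrightarrow> finite (nodes G)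
     \<and> dir G \<subseteq> nodes G \<times> nodes G \<and> und G \<subseteq> nodes G \<times> nodes G
     \<and> sym (und G) \<and> irrefl (dir G) \<and> irrefl (und G)
     \<and> dir G \<inter> und G = {} \<and> (\<forall>u v. (u, v) \<in> dir G \<longrightarrow> (v, u) \<notin> dir G)"

definition pdag :: "'v pgraph \<Rightarrow> bool" where
  "pdag G \<longleftrightarrow> simple_graph G \<and> acyclic (dir G)"

definition dag :: "'v pgraph \<Rightarrow> bool" where
  "dag G \<longleftrightarrow> pdag G \<and> und G = {}"

text \<open>The four existentials are the four forbidden induced subgraphs. In the last two, distinctness
  of the non-adjacent pair has to be stated, because a node is not adjacent to itself.\<close>

definition maximal_pdag :: "'v pgraph \<Rightarrow> bool" where
  "maximal_pdag G \<longleftrightarrow> pdag G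
     \<and> \<not> (\<exists>a b c. a \<noteq> c \<and> (a, b) \<in> dir G \<and> (b, c) \<in> und G \<and> \<not> adj G a c)
     \<and> \<not> (\<exists>a b c. (a, b) \<in> dir G \<and> (b, c) \<in> dir G \<and> (a, c) \<in> und G)
     \<and> \<not> (\<exists>a b c d. b \<noteq> c \<and> (b, d) \<in> dir G \<and> (c, d) \<in> dir G
            \<and> (a, d) \<in> und G \<and> (a, b) \<in> und G \<and> (a, c) \<in> und G \<and> \<not> adj G b c)
     \<and> \<not> (\<exists>a b c d. b \<noteq> d \<and> (b, c) \<in> dir G \<and> (c, d) \<in> dir G
            \<and> (a, b) \<in> und G \<and> (a, c) \<in> und G \<and> (a, d) \<in> und G \<and> \<not> adj G b d)"

definition v_structures :: "'v pgraph \<Rightarrow> ('v \<times> 'v \<times> 'v) set" where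
  "v_structures G =
     {(u, v, w). (u, v) \<in> dir G \<and> (w, v) \<in> dir G \<and> u \<noteq> w \<and> \<not> adj G u w}"

definition represented_dags :: "'v pgraph \<Rightarrow> 'v pgraph set" where
  "represented_dags G = {D. dag D \<and> nodes D = nodes G \<and> (\<forall>u v. adj D u v \<longleftrightarrow> adj G u v)
     \<and> v_structures D = v_structures G \<and> dir G \<subseteq> dir D}"


section \<open>Paths\<close>

definition is_path :: "'v pgraph \<Rightarrow> 'v list \<Rightarrow> bool" where
  "is_path G p \<longleftrightarrow> p \<noteq> [] \<and> distinct p \<and> set p \<subseteq> nodes G
     \<and> (\<forall>i. Suc i < length p \<longrightarrow> adj G (p ! i) (p ! Suc i))"

definition path_from_to :: "'v pgraph \<Rightarrow> 'v set \<Rightarrow> 'v set \<Rightarrow> 'v list \<Rightarrow> bool" where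
  "path_from_to G A B p \<longleftrightarrow> is_path G p \<and> hd p \<in> A \<and> last p \<in> B"

definition proper_path :: "'v pgraph \<Rightarrow> 'v set \<Rightarrow> 'v set \<Rightarrow> 'v list \<Rightarrow> bool" where
  "proper_path G A B p \<longleftrightarrow> path_from_to G A B p \<and> set (tl p) \<inter> A = {}"

definition causal :: "'v pgraph \<Rightarrow> 'v list \<Rightarrow> bool" where
  "causal G p \<longleftrightarrow> (\<forall>i. Suc i < length p \<longrightarrow> (p ! i, p ! Suc i) \<in> dir G)"

definition possibly_causal :: "'v pgraph \<Rightarrow> 'v list \<Rightarrow> bool" where
  "possibly_causal G p \<longleftrightarrow> \<not> (\<exists>i j. i < j \<and> j < length p \<and> (p ! j, p ! i) \<in> dir G)"

text \<open>In a graph without directed cycles every causal path is possibly causal.\<close>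

definition non_causal :: "'v pgraph \<Rightarrow> 'v list \<Rightarrow> bool" where
  "non_causal G p \<longleftrightarrow> \<not> causal G p \<and> \<not> possibly_causal G p"

definition pa :: "'v pgraph \<Rightarrow> 'v \<Rightarrow> 'v set" where
  "pa G v = {u. (u, v) \<in> dir G}"

definition de :: "'v pgraph \<Rightarrow> 'v \<Rightarrow> 'v set" where
  "de G v = {w. \<exists>p. path_from_to G {v} {w} p \<and> causal G p}"

definition possde :: "'v pgraph \<Rightarrow> 'v set \<Rightarrow> 'v set" where
  "possde G A = (\<Union>v\<in>A. {w. \<exists>p. path_from_to G {v} {w} p \<and> possibly_causal G p})"


section \<open>d-separation\<close>

text \<open>The argument \<open>i\<close> is the position of the node on the path.\<close>

definition collider_at :: "'v pgraph \<Rightarrow> 'v list \<Rightarrow> nat \<Rightarrow> bool" where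
  "collider_at G p i \<longleftrightarrow> 0 < i \<and> Suc i < length p
     \<and> (p ! (i - 1), p ! i) \<in> dir G \<and> (p ! Suc i, p ! i) \<in> dir G"

definition non_collider_at :: "'v pgraph \<Rightarrow> 'v list \<Rightarrow> nat \<Rightarrow> bool" where
  "non_collider_at G p i \<longleftrightarrow> 0 < i \<and> Suc i < length p
     \<and> ((p ! i, p ! (i - 1)) \<in> dir G \<or> (p ! i, p ! Suc i) \<in> dir G
        \<or> ((p ! (i - 1), p ! i) \<in> und G \<and> (p ! i, p ! Suc i) \<in> und G
           \<and> \<not> adj G (p ! (i - 1)) (p ! Suc i)))"

definition definite_status :: "'v pgraph \<Rightarrow> 'v list \<Rightarrow> bool" where
  "definite_status G p \<longleftrightarrow>
     (\<forall>i. 0 < i \<and> Suc i < length p \<longrightarrow> collider_at G p i \<or> non_collider_at G p i)"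

definition blocked :: "'v pgraph \<Rightarrow> 'v set \<Rightarrow> 'v list \<Rightarrow> bool" where
  "blocked G Z p \<longleftrightarrow>
     (\<exists>i. non_collider_at G p i \<and> p ! i \<in> Z) \<or>
     (\<exists>i. collider_at G p i \<and> de G (p ! i) \<inter> Z = {})"

text \<open>Only meaningful, and below only used, for pairwise disjoint \<open>A\<close>, \<open>B\<close>, \<open>Z\<close>.\<close>

definition dsep :: "'v pgraph \<Rightarrow> 'v set \<Rightarrow> 'v set \<Rightarrow> 'v set \<Rightarrow> bool" where
  "dsep G A B Z \<longleftrightarrow>
     (\<forall>p. path_from_to G A B p \<and> definite_status G p \<longrightarrow> blocked G Z p)"


section \<open>Valid adjustment sets, comparison criterion, pruning\<close>

definition posscn :: "'v pgraph \<Rightarrow> 'v set \<Rightarrow> 'v set \<Rightarrow> 'v set" where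
  "posscn G X Y = (\<Union>p\<in>{p. proper_path G X Y p \<and> possibly_causal G p}. set p) - X"

definition forb :: "'v pgraph \<Rightarrow> 'v set \<Rightarrow> 'v set \<Rightarrow> 'v set" where
  "forb G X Y = possde G (posscn G X Y) \<union> X"

definition amenable :: "'v pgraph \<Rightarrow> 'v set \<Rightarrow> 'v set \<Rightarrow> bool" where
  "amenable G X Y \<longleftrightarrow>
     (\<forall>p. proper_path G X Y p \<and> possibly_causal G p \<longrightarrow> (p ! 0, p ! 1) \<in> dir G)"

definition valid_adjustment_set ::
  "'v pgraph \<Rightarrow> 'v set \<Rightarrow> 'v set \<Rightarrow> 'v set \<Rightarrow> bool" where
  "valid_adjustment_set G X Y Z \<longleftrightarrow>
     Z \<subseteq> nodes G \<and> Z \<inter> (X \<union> Y) = {}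
     \<and> amenable G X Y
     \<and> Z \<inter> forb G X Y = {}
     \<and> (\<forall>p. proper_path G X Y p \<and> non_causal G p \<and> definite_status G p \<longrightarrow> blocked G Z p)"

definition criterion_applies ::
  "'v pgraph \<Rightarrow> 'v set \<Rightarrow> 'v set \<Rightarrow> 'v set \<Rightarrow> 'v set \<Rightarrow> bool" where
  "criterion_applies G X Y Z1 Z2 \<longleftrightarrow>
     valid_adjustment_set G X Y Z1 \<and> valid_adjustment_set G X Y Z2
     \<and> dsep G Y (Z1 - Z2) (X \<union> Z2) \<and> dsep G X (Z2 - Z1) Z1"

definition prune_step ::
  "'v pgraph \<Rightarrow> 'v set \<Rightarrow> 'v set \<Rightarrow> 'v set \<Rightarrow> 'v \<Rightarrow> 'v set" where
  "prune_step G X Y S z = (if dsep G Y {z} (X \<union> (S - {z})) then S - {z} else S)"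

text \<open>\<open>zs\<close> is an enumeration of \<open>Z\<close>, fixing the order in which the nodes are considered.\<close>

definition prune ::
  "'v pgraph \<Rightarrow> 'v set \<Rightarrow> 'v set \<Rightarrow> 'v set \<Rightarrow> 'v list \<Rightarrow> 'v set" where
  "prune G X Y Z zs = foldl (prune_step G X Y) Z zs"


section \<open>Covariances and asymptotic variances\<close>

definition covariance :: "'w measure \<Rightarrow> ('w \<Rightarrow> real) \<Rightarrow> ('w \<Rightarrow> real) \<Rightarrow> real" where
  "covariance M f g =
     (\<integral>\<omega>. (f \<omega> - integral\<^sup>L M f) * (g \<omega> - integral\<^sup>L M g) \<partial>M)"

text \<open>Matrices whose rows and columns are indexed by a finite set \<open>T\<close> of nodes are functions
  of two nodes, of which only the values on \<open>T \<times> T\<close> matter.\<close>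

definition is_inverse_on :: "'v set \<Rightarrow> ('v \<Rightarrow> 'v \<Rightarrow> real) \<Rightarrow> ('v \<Rightarrow> 'v \<Rightarrow> real) \<Rightarrow> bool" where
  "is_inverse_on T A B \<longleftrightarrow> (\<forall>i\<in>T. \<forall>j\<in>T.
     (\<Sum>k\<in>T. A i k * B k j) = (if i = j then 1 else 0) \<and>
     (\<Sum>k\<in>T. B i k * A k j) = (if i = j then 1 else 0))"

definition nonsingular_on :: "'v set \<Rightarrow> ('v \<Rightarrow> 'v \<Rightarrow> real) \<Rightarrow> bool" where
  "nonsingular_on T A \<longleftrightarrow> (\<exists>B. is_inverse_on T A B)"

text \<open>The values of an inverse on \<open>T \<times> T\<close> are unique.\<close>

definition inverse_on :: "'v set \<Rightarrow> ('v \<Rightarrow> 'v \<Rightarrow> real) \<Rightarrow> ('v \<Rightarrow> 'v \<Rightarrow> real)" where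
  "inverse_on T A = (SOME B. is_inverse_on T A B)"

text \<open>The \<open>(s, s')\<close> entry of \<open>\<Sigma>\<^sub>s\<^sub>s - \<Sigma>\<^sub>s\<^sub>t \<Sigma>\<^sub>t\<^sub>t\<inverse> \<Sigma>\<^sub>t\<^sub>s\<close>.\<close>

definition partial_cov :: "('v \<Rightarrow> 'v \<Rightarrow> real) \<Rightarrow> 'v set \<Rightarrow> 'v \<Rightarrow> 'v \<Rightarrow> real" where
  "partial_cov \<Sigma> T s s' =
     \<Sigma> s s' - (\<Sum>t\<in>T. \<Sum>t'\<in>T. \<Sigma> s t * inverse_on T \<Sigma> t t' * \<Sigma> t' s')"

definition cov_matrix :: "'w measure \<Rightarrow> ('v \<Rightarrow> 'w \<Rightarrow> real) \<Rightarrow> 'v \<Rightarrow> 'v \<Rightarrow> real" where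
  "cov_matrix M V i j = covariance M (V i) (V j)"

definition avar ::
  "'w measure \<Rightarrow> ('v \<Rightarrow> 'w \<Rightarrow> real) \<Rightarrow> 'v set \<Rightarrow> 'v set \<Rightarrow> 'v \<Rightarrow> 'v \<Rightarrow> real" where
  "avar M V X Z y x =
     partial_cov (cov_matrix M V) (X \<union> Z) y y
       / partial_cov (cov_matrix M V) ((X - {x}) \<union> Z) x x"


section \<open>Causal linear models\<close>

text \<open>Densities on the node set \<open>N\<close> are taken with respect to a product of \<open>\<sigma>\<close>-finite Borel
  measures \<open>\<mu> i\<close> (Lebesgue measure for continuous variables).
  In \<open>marginal_density \<mu> N f S u\<close> the coordinates outside \<open>S\<close> are integrated out.\<close>

definition marginal_density ::
  "('v \<Rightarrow> real measure) \<Rightarrow> 'v set \<Rightarrow> (('v \<Rightarrow> real) \<Rightarrow> ennreal) \<Rightarrow> 'v set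
     \<Rightarrow> ('v \<Rightarrow> real) \<Rightarrow> ennreal" where
  "marginal_density \<mu> N f S u =
     (\<integral>\<^sup>+ w. f (merge S (N - S) (u, w)) \<partial>PiM (N - S) \<mu>)"

text \<open>\<open>\<kappa>\<close> is a version of the conditional density of coordinate \<open>i\<close> given the coordinates in \<open>P\<close>,
  as a function of the coordinates in \<open>insert i P\<close>.\<close>

definition conditional_density ::
  "('v \<Rightarrow> real measure) \<Rightarrow> 'v set \<Rightarrow> (('v \<Rightarrow> real) \<Rightarrow> ennreal) \<Rightarrow> 'v \<Rightarrow> 'v set
     \<Rightarrow> (('v \<Rightarrow> real) \<Rightarrow> ennreal) \<Rightarrow> bool" where
  "conditional_density \<mu> N f i P \<kappa> \<longleftrightarrow>
     \<kappa> \<in> borel_measurable (PiM (insert i P) \<mu>)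
     \<and> (\<forall>u\<in>space (PiM P \<mu>). (\<integral>\<^sup>+ y. \<kappa> (u(i := y)) \<partial>\<mu> i) = 1)
     \<and> (AE u in PiM (insert i P) \<mu>.
          marginal_density \<mu> N f (insert i P) u
            = \<kappa> u * marginal_density \<mu> N f P (restrict u P))"

text \<open>\<open>fdo A a v\<close> stands for the interventional density of \<open>v\<close> under \<open>do(A = a)\<close>. It is a density
  in the coordinates outside \<open>A\<close>, so the truncated factorisation is required almost everywhere in
  these, for each value \<open>a\<close>. Versions of the conditional densities are chosen once and for all,
  since \<open>a\<close> may lie outside the support of the observational distribution. Intervening on no
  variable leaves the observational density.\<close>

definition compatible_density ::
  "('v \<Rightarrow> real measure) \<Rightarrow> (('v \<Rightarrow> real) \<Rightarrow> ennreal)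
     \<Rightarrow> ('v set \<Rightarrow> ('v \<Rightarrow> real) \<Rightarrow> ('v \<Rightarrow> real) \<Rightarrow> ennreal) \<Rightarrow> 'v pgraph \<Rightarrow> bool" where
  "compatible_density \<mu> f fdo D \<longleftrightarrow>
     (AE v in PiM (nodes D) \<mu>. fdo {} (\<lambda>_. undefined) v = f v)
     \<and> (\<exists>\<kappa>. (\<forall>i\<in>nodes D. conditional_density \<mu> (nodes D) f i (pa D i) (\<kappa> i))
          \<and> (\<forall>A a. A \<subseteq> nodes D \<and> a \<in> A \<rightarrow>\<^sub>E UNIV \<longrightarrow>
               (AE w in PiM (nodes D - A) \<mu>.
                  let v = merge A (nodes D - A) (a, w) in
                  fdo A a v = (\<Prod>i\<in>nodes D - A. \<kappa> i (restrict v (insert i (pa D i)))))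
             \<and> (\<forall>v\<in>nodes D \<rightarrow>\<^sub>E UNIV. (\<exists>i\<in>A. v i \<noteq> a i) \<longrightarrow> fdo A a v = 0)))"

definition causal_linear_model_dag ::
  "'w measure \<Rightarrow> ('v \<Rightarrow> real measure) \<Rightarrow> ('v \<Rightarrow> 'w \<Rightarrow> real) \<Rightarrow> (('v \<Rightarrow> real) \<Rightarrow> ennreal)
     \<Rightarrow> ('v set \<Rightarrow> ('v \<Rightarrow> real) \<Rightarrow> ('v \<Rightarrow> real) \<Rightarrow> ennreal) \<Rightarrow> 'v pgraph \<Rightarrow> bool" where
  "causal_linear_model_dag M \<mu> V f fdo D \<longleftrightarrow>
     prob_space M
     \<and> (\<forall>i\<in>nodes D. sigma_finite_measure (\<mu> i) \<and> sets (\<mu> i) = sets borel)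
     \<and> distributed M (PiM (nodes D) \<mu>) (\<lambda>\<omega>. \<lambda>i\<in>nodes D. V i \<omega>) f
     \<and> compatible_density \<mu> f fdo D
     \<and> (\<exists>\<alpha> \<epsilon>. prob_space.indep_vars M (\<lambda>_. borel) \<epsilon> (nodes D)
          \<and> (\<forall>i\<in>nodes D. integrable M (\<lambda>\<omega>. (\<epsilon> i \<omega>)\<^sup>2) \<and> integral\<^sup>L M (\<epsilon> i) = 0
               \<and> (AE \<omega> in M. V i \<omega> = (\<Sum>j\<in>pa D i. \<alpha> i j * V j \<omega>) + \<epsilon> i \<omega>)))
     \<and> nonsingular_on (nodes D) (cov_matrix M V)"

definition causal_linear_model ::
  "'w measure \<Rightarrow> ('v \<Rightarrow> real measure) \<Rightarrow> ('v \<Rightarrow> 'w \<Rightarrow> real) \<Rightarrow> (('v \<Rightarrow> real) \<Rightarrow> ennreal)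
     \<Rightarrow> ('v set \<Rightarrow> ('v \<Rightarrow> real) \<Rightarrow> ('v \<Rightarrow> real) \<Rightarrow> ennreal) \<Rightarrow> 'v pgraph \<Rightarrow> bool" where
  "causal_linear_model M \<mu> V f fdo G \<longleftrightarrow>
     (\<exists>D\<in>represented_dags G. causal_linear_model_dag M \<mu> V f fdo D)"

end

theory Submission
  imports Defs
begin

text \<open>
  Fix a DAG \<open>D\<close> in \<open>[G]\<close> with which the model is compatible. Everything rests on one translation:
  d-separation in \<open>G\<close> is the same as the absence of an open walk in \<open>D\<close>
  (\<open>dsep_iff_walk_sep\<close>). An open definite status path of \<open>G\<close> is an open walk of \<open>D\<close>, because the two
  graphs have the same v-structures. Conversely, among the open walks of \<open>D\<close> between two nodes take one
  whose nodes have the fewest descendants in total. Cutting off a corner of a triangle, and replacing a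
  collider by one of its children, would both lower this number. Hence the colliders of the walk are
  unshielded, its non-colliders have definite status already in \<open>G\<close>, and a shortest directed path
  from a collider to the conditioning set is directed in \<open>G\<close>, since \<open>a \<rightarrow> b - c\<close> with \<open>a, c\<close>
  non-adjacent does not occur in \<open>G\<close>.

  For walks, as opposed to paths, the graphoid laws weak union, contraction and intersection are mere
  cutting and pasting. Let \<open>R\<close> be the set of all \<open>z \<in> Z\<close> that are separated from \<open>Y\<close> given
  \<open>X \<union> (Z - {z})\<close>. By intersection all of \<open>R\<close> is separated from \<open>Y\<close> given \<open>X \<union> (Z - R)\<close>. By weak
  union a node of \<open>R\<close> can still be removed after any other nodes of \<open>R\<close> have been removed, and by
  contraction no node outside \<open>R\<close> ever can. So the output is \<open>Z - R\<close> in every order. If the criterion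
  applies to \<open>(Z - R, Z'')\<close>, then by intersection no node of \<open>Z - R\<close> outside \<open>Z''\<close> could have survived
  the pruning. Hence \<open>Z - R \<subseteq> Z''\<close>, and the criterion applies to \<open>(Z'', Z - R)\<close> as well.

  Removing one node \<open>z\<close> keeps the adjustment set valid: a proper non-causal path that becomes open has
  \<open>z\<close> as a non-collider, and its part from \<open>z\<close> to \<open>Y\<close>, which avoids \<open>X\<close>, contradicts the
  separation of \<open>z\<close> from \<open>Y\<close>. The removal does not increase the asymptotic variance: by the Markov
  property of linear models (\<open>walk_sep_imp_uncorrelated\<close>) the residual of \<open>y\<close> is uncorrelated with
  \<open>z\<close>, so the numerator does not change, whereas the residual variance of \<open>x\<close> in the denominator
  can only grow when there are fewer regressors. The Markov property itself is a statement about
  orthogonal projections: if \<open>a\<close> and \<open>b\<close> are separated by \<open>W\<close>, the errors of the ancestors of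
  \<open>a\<close>, \<open>b\<close> and \<open>W\<close> fall into two mutually orthogonal groups, one for each side, and the residual of \<open>a\<close> on \<open>W\<close> lies in
  the span of one group while that of \<open>b\<close> lies in the span of the other.
\<close>

section \<open>Open walks in a directed graph\<close>

definition anc :: "('v \<times> 'v) set \<Rightarrow> 'v set \<Rightarrow> 'v set" where
  "anc r W = {v. \<exists>w\<in>W. (v, w) \<in> r\<^sup>*}"

definition passable :: "('v \<times> 'v) set \<Rightarrow> 'v set \<Rightarrow> 'v \<Rightarrow> 'v \<Rightarrow> 'v \<Rightarrow> bool" where
  "passable r W x v y \<longleftrightarrow> (if (x, v) \<in> r \<and> (y, v) \<in> r then v \<in> anc r W else v \<notin> W)"

abbreviation linked :: "('v \<times> 'v) set \<Rightarrow> 'v \<Rightarrow> 'v \<Rightarrow> bool" where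
  "linked r u v \<equiv> (u, v) \<in> r \<or> (v, u) \<in> r"

text \<open>The blocking rule of d-separation, applied triple by triple. Nodes may repeat on a walk, so walks can be
  glued together without regard to distinctness.\<close>

fun open_walk :: "('v \<times> 'v) set \<Rightarrow> 'v set \<Rightarrow> 'v list \<Rightarrow> bool" where
  "open_walk r W [] \<longleftrightarrow> False"
| "open_walk r W [u] \<longleftrightarrow> True"
| "open_walk r W [u, v] \<longleftrightarrow> linked r u v"
| "open_walk r W (u # v # w # p) \<longleftrightarrow> linked r u v \<and> passable r W u v w \<and> open_walk r W (v # w # p)"

lemma anc_mono: "W \<subseteq> W' \<Longrightarrow> anc r W \<subseteq> anc r W'"
  by (auto simp: anc_def)

lemma anc_superset: "W \<subseteq> anc r W"
  by (auto simp: anc_def)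

lemma anc_step: "(u, v) \<in> r \<Longrightarrow> v \<in> anc r W \<Longrightarrow> u \<in> anc r W"
  by (auto simp: anc_def intro: converse_rtrancl_into_rtrancl)

lemma passable_commute: "passable r W x v y \<longleftrightarrow> passable r W y v x"
  by (auto simp: passable_def)

lemma acyclic_asym: "acyclic r \<Longrightarrow> (u, v) \<in> r \<Longrightarrow> (v, u) \<notin> r"
  unfolding acyclic_def by (meson r_into_trancl trancl_into_trancl)

lemma passable_out:
  "acyclic r \<Longrightarrow> (v, x) \<in> r \<or> (v, y) \<in> r \<Longrightarrow> passable r W x v y \<longleftrightarrow> v \<notin> W"
  using acyclic_asym[of r v] by (auto simp: passable_def)

lemma open_walk_append:
  "open_walk r W (xs @ u # v # ys) \<longleftrightarrow> open_walk r W (xs @ [u, v]) \<and> open_walk r W (u # v # ys)"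
proof (induction r W xs rule: open_walk.induct)
  case (1 r W)
  then show ?case by (cases ys) auto
next
  case (2 r W x)
  then show ?case by (cases ys) auto
next
  case (3 r W x y)
  then show ?case by (cases ys) auto
qed auto

lemma open_walk_Cons2:
  "open_walk r W (u # v # ys) \<longleftrightarrow>
     linked r u v \<and> (ys \<noteq> [] \<longrightarrow> passable r W u v (hd ys)) \<and> open_walk r W (v # ys)"
  by (cases ys) auto

lemma open_walk_linked: "open_walk r W (xs @ [u, v]) \<Longrightarrow> linked r u v"
  by (induction r W xs rule: open_walk.induct) auto

lemma open_walk_snoc2:
  "open_walk r W (xs @ [u, v]) \<longleftrightarrow>
     linked r u v \<and> (xs \<noteq> [] \<longrightarrow> passable r W (last xs) u v) \<and> open_walk r W (xs @ [u])"
proof (cases xs rule: rev_cases)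
  case (snoc zs z)
  then show ?thesis using open_walk_append[of r W zs z u "[v]"] open_walk_linked[of r W zs z u] by auto
qed auto

lemma open_walk_rev: "open_walk r W (rev p) \<longleftrightarrow> open_walk r W p"
proof (induction r W p rule: open_walk.induct)
  case (4 r W u v w p)
  have "open_walk r W (rev (u # v # w # p)) \<longleftrightarrow> open_walk r W (rev p @ [w, v]) \<and> open_walk r W [w, v, u]"
    using open_walk_append[of r W "rev p" w v "[u]"] by simp
  with 4 passable_commute[of r W w v u] open_walk_Cons2[of r W v w p] show ?case by auto
qed auto

lemma open_walk_prefix: "open_walk r W (xs @ v # ys) \<Longrightarrow> open_walk r W (xs @ [v])"
proof (cases ys)
  case (Cons y zs)
  assume "open_walk r W (xs @ v # ys)"
  with Cons open_walk_append[of r W xs v y zs] open_walk_snoc2[of r W xs v y] show ?thesis by simp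
qed simp

lemma open_walk_suffix: "open_walk r W (xs @ v # ys) \<Longrightarrow> open_walk r W (v # ys)"
  using open_walk_prefix[of r W "rev ys" v "rev xs"] open_walk_rev[of r W "xs @ v # ys"]
    open_walk_rev[of r W "v # ys"] by simp

lemma open_walk_join:
  "open_walk r W (xs @ v # ys) \<longleftrightarrow> open_walk r W (xs @ [v]) \<and> open_walk r W (v # ys)
     \<and> (xs \<noteq> [] \<and> ys \<noteq> [] \<longrightarrow> passable r W (last xs) v (hd ys))"
proof (cases ys)
  case (Cons y zs)
  then show ?thesis
    using open_walk_append[of r W xs v y zs] open_walk_snoc2[of r W xs v y]
      open_walk_Cons2[of r W v y zs] by auto
qed auto

lemma open_walk_nth:
  "open_walk r W p \<longleftrightarrow> p \<noteq> [] \<and> (\<forall>i. Suc i < length p \<longrightarrow> linked r (p ! i) (p ! Suc i))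
     \<and> (\<forall>i. 0 < i \<and> Suc i < length p \<longrightarrow> passable r W (p ! (i - 1)) (p ! i) (p ! Suc i))"
proof (induction r W p rule: open_walk.induct)
  case (4 r W u v w p)
  have shift: "(\<forall>i. P i) \<longleftrightarrow> P 0 \<and> (\<forall>i. P (Suc i))" for P :: "nat \<Rightarrow> bool"
    by (metis not0_implies_Suc)
  let ?q = "v # w # p"
  have 1: "(\<forall>i. Suc i < length (u # ?q) \<longrightarrow> linked r ((u # ?q) ! i) ((u # ?q) ! Suc i)) \<longleftrightarrow>
     linked r u v \<and> (\<forall>i. Suc i < length ?q \<longrightarrow> linked r (?q ! i) (?q ! Suc i))"
    by (subst shift) auto
  have "(\<forall>i. 0 < i \<and> Suc i < length (u # ?q) \<longrightarrow>
        passable r W ((u # ?q) ! (i - 1)) ((u # ?q) ! i) ((u # ?q) ! Suc i)) \<longleftrightarrow>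
     (\<forall>i. Suc i < length ?q \<longrightarrow> passable r W ((u # ?q) ! i) (?q ! i) (?q ! Suc i))"
    by (subst shift) auto
  also have "\<dots> \<longleftrightarrow> passable r W u v w \<and> (\<forall>i. Suc (Suc i) < length ?q \<longrightarrow>
        passable r W (?q ! i) (?q ! Suc i) (?q ! Suc (Suc i)))"
    by (subst shift) auto
  also have "(\<forall>i. Suc (Suc i) < length ?q \<longrightarrow>
        passable r W (?q ! i) (?q ! Suc i) (?q ! Suc (Suc i))) \<longleftrightarrow>
     (\<forall>i. 0 < i \<and> Suc i < length ?q \<longrightarrow> passable r W (?q ! (i - 1)) (?q ! i) (?q ! Suc i))"
    by (subst (2) shift) auto
  finally have 2: "(\<forall>i. 0 < i \<and> Suc i < length (u # ?q) \<longrightarrow>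
        passable r W ((u # ?q) ! (i - 1)) ((u # ?q) ! i) ((u # ?q) ! Suc i)) \<longleftrightarrow>
     passable r W u v w \<and> (\<forall>i. 0 < i \<and> Suc i < length ?q \<longrightarrow>
        passable r W (?q ! (i - 1)) (?q ! i) (?q ! Suc i))" .
  show ?case unfolding 1 2 open_walk.simps(4) 4 by auto
qed (auto simp: less_Suc_eq)

lemma open_walk_weaken:
  assumes "open_walk r W p" "W \<subseteq> W'" "\<forall>v\<in>set (butlast (tl p)). v \<in> W' \<longrightarrow> v \<in> W"
  shows "open_walk r W' p"
  using assms
proof (induction r W p rule: open_walk.induct)
  case (4 r W u v w p)
  then have "open_walk r W' (v # w # p)"
    by (cases p) (auto split: if_splits)
  moreover have "passable r W' u v w"
    using 4 anc_mono[OF \<open>W \<subseteq> W'\<close>, of r] by (auto simp: passable_def split: if_splits)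
  ultimately show ?case using 4 by auto
qed auto

text \<open>A walk whose last node has no descendant in \<open>W\<close> can be continued along any directed path: each
  node on that path is a non-collider outside \<open>W\<close>.\<close>

lemma open_walk_directed:
  assumes "acyclic r" "open_walk r W p" "(last p, v) \<in> r\<^sup>*" "last p \<notin> anc r W"
  shows "\<exists>q. open_walk r W (p @ q) \<and> last (p @ q) = v"
  using assms(3,4,2)
proof (induction "last p" arbitrary: p rule: converse_rtrancl_induct)
  case base
  then show ?case by (intro exI[of _ "[]"]) simp
next
  case (step z p)
  obtain xs where p: "p = xs @ [last p]"
    using \<open>open_walk r W p\<close> by (cases p rule: rev_cases) auto
  have "last p \<notin> W"
    using step.prems anc_superset[of W r] by auto
  then have "open_walk r W (xs @ [last p, z])"
    using p step.prems step.hyps(1) passable_out[OF assms(1), of "last p" _ z W]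
    unfolding open_walk_snoc2 by auto
  then have "open_walk r W (p @ [z])"
    by (metis p append_assoc append_Cons append_Nil)
  moreover have "z \<notin> anc r W"
    using step anc_step by metis
  ultimately obtain q where "open_walk r W ((p @ [z]) @ q) \<and> last ((p @ [z]) @ q) = v"
    using step.hyps(3)[of "p @ [z]"] by auto
  then show ?case by (intro exI[of _ "z # q"]) auto
qed

section \<open>Graphoid laws\<close>

definition walk_sep :: "('v \<times> 'v) set \<Rightarrow> 'v set \<Rightarrow> 'v set \<Rightarrow> 'v set \<Rightarrow> bool" where
  "walk_sep r A B W \<longleftrightarrow> \<not> (\<exists>p. open_walk r W p \<and> hd p \<in> A \<and> last p \<in> B)"

lemma walk_sep_mono: "walk_sep r A B W \<Longrightarrow> B' \<subseteq> B \<Longrightarrow> walk_sep r A B' W"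
  by (auto simp: walk_sep_def)

text \<open>On a walk that is open given \<open>W \<union> C\<close>, look at the first collider that has a descendant in \<open>C\<close> but none
  in \<open>W\<close>. The walk up to there, continued along a directed path into \<open>C\<close>, is open given \<open>W\<close>.\<close>

lemma walk_sep_weak_union:
  assumes r: "acyclic r" and sep: "walk_sep r A (B \<union> C) W"
  shows "walk_sep r A B (W \<union> C)"
  unfolding walk_sep_def
proof
  assume "\<exists>p. open_walk r (W \<union> C) p \<and> hd p \<in> A \<and> last p \<in> B"
  then obtain p where p: "open_walk r (W \<union> C) p" "hd p \<in> A" "last p \<in> B" by auto
  have "open_walk r (W \<union> C) q \<Longrightarrow> hd q \<in> A \<Longrightarrow> open_walk r W q" for q
  proof (induction q rule: rev_induct)
    case (snoc v q)
    show ?case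
    proof (cases q rule: rev_cases)
      case (snoc q' u)
      have q: "open_walk r W q" "hd q \<in> A"
        using snoc snoc.prems snoc.IH open_walk_prefix[of r "W \<union> C" q' u "[v]"] by (cases q'; simp)+
      have "passable r W (last q') u v" if "q' \<noteq> []"
      proof (rule ccontr)
        assume np: "\<not> passable r W (last q') u v"
        have "passable r (W \<union> C) (last q') u v"
          using snoc snoc.prems that open_walk_snoc2[of r "W \<union> C" q' u v] by simp
        with np have "u \<notin> anc r W" "u \<in> anc r (W \<union> C)"
          by (auto simp: passable_def split: if_splits)
        then obtain c where c: "c \<in> C" "(u, c) \<in> r\<^sup>*"
          by (auto simp: anc_def)
        obtain q'' where "open_walk r W (q @ q'')" "last (q @ q'') = c"
          using open_walk_directed[OF r q(1)] c \<open>u \<notin> anc r W\<close> snoc by auto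
        moreover have "hd (q @ q'') \<in> A"
          using q by (cases q) auto
        ultimately show False
          using sep c by (auto simp: walk_sep_def)
      qed
      then show ?thesis
        using q snoc snoc.prems open_walk_snoc2[of r _ q' u v] by simp
    qed auto
  qed auto
  with p have "open_walk r W p" by blast
  with p sep show False by (auto simp: walk_sep_def)
qed

lemma first_hit:
  assumes "open_walk r W p" "hd p \<in> A" "\<exists>v\<in>set p. v \<in> R"
  obtains q where "open_walk r W q" "hd q \<in> A" "last q \<in> R" "\<forall>v\<in>set (butlast q). v \<notin> R"
proof -
  obtain xs v ys where "p = xs @ v # ys" "v \<in> R" "\<forall>x\<in>set xs. x \<notin> R"
    using split_list_first_prop[OF assms(3)] by blast
  with assms open_walk_prefix[of r W xs v ys] that[of "xs @ [v]"] show thesis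
    by (cases xs) auto
qed

lemma set_butlast_tl: "set (butlast (tl q)) \<subseteq> set (butlast q)"
  by (cases q) auto

text \<open>A walk that is open given \<open>W\<close> and avoids \<open>C\<close> stays open given \<open>W \<union> C\<close>; one that meets \<open>C\<close>
  can be stopped there.\<close>

lemma walk_sep_contraction:
  assumes "walk_sep r A B (W \<union> C)" "walk_sep r A C W"
  shows "walk_sep r A (B \<union> C) W"
  unfolding walk_sep_def
proof
  assume "\<exists>p. open_walk r W p \<and> hd p \<in> A \<and> last p \<in> B \<union> C"
  then obtain p where p: "open_walk r W p" "hd p \<in> A" "last p \<in> B \<union> C" by blast
  show False
  proof (cases "\<exists>v\<in>set p. v \<in> C")
    case True
    obtain q where "open_walk r W q" "hd q \<in> A" "last q \<in> C"
      using first_hit[OF p(1,2) True] by metis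
    with assms(2) show ?thesis unfolding walk_sep_def by blast
  next
    case False
    have "p \<noteq> []" using p(1) by auto
    then have "last p \<in> set p" by simp
    moreover have "set (butlast (tl p)) \<subseteq> set p"
      by (meson in_set_butlastD list.set_sel(2) subsetI \<open>p \<noteq> []\<close>)
    ultimately have "open_walk r (W \<union> C) p" "last p \<in> B"
      using p False open_walk_weaken[OF p(1), of "W \<union> C"] by auto
    with p(2) assms(1) show ?thesis unfolding walk_sep_def by blast
  qed
qed

text \<open>Stop an open walk at its first node in \<open>R\<close>. None of its other nodes lies in \<open>R\<close>, so adding any
  other part of \<open>R\<close> to the conditioning set leaves the walk open. The assumption covers both the
  separation of \<open>R\<close> node by node and the usual law for two disjoint sets.\<close>

lemma walk_sep_intersection:
  assumes "\<And>x. x \<in> R \<Longrightarrow> \<exists>B\<subseteq>R. x \<in> B \<and> walk_sep r A B (W \<union> (R - B))"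
  shows "walk_sep r A R W"
  unfolding walk_sep_def
proof
  assume "\<exists>p. open_walk r W p \<and> hd p \<in> A \<and> last p \<in> R"
  then obtain p where p: "open_walk r W p" "hd p \<in> A" "last p \<in> R" by blast
  moreover have "p \<noteq> []" using p(1) by auto
  then have "\<exists>v\<in>set p. v \<in> R" using p(3) last_in_set by blast
  ultimately obtain q where q: "open_walk r W q" "hd q \<in> A" "last q \<in> R" "\<forall>v\<in>set (butlast q). v \<notin> R"
    using first_hit[of r W p A R] by metis
  obtain B where B: "B \<subseteq> R" "last q \<in> B" "walk_sep r A B (W \<union> (R - B))"
    using assms q(3) by blast
  have "open_walk r (W \<union> (R - B)) q"
    using open_walk_weaken[OF q(1), of "W \<union> (R - B)"] q(4) set_butlast_tl[of q] by auto
  with B q(2) show False unfolding walk_sep_def by blast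
qed

section \<open>Minimal open walks\<close>

text \<open>Counting descendants makes both reductions of a walk decrease one and the same number: removing a
  node, which counts at least itself, and replacing a node by one of its children.\<close>

definition weight :: "('v \<times> 'v) set \<Rightarrow> 'v list \<Rightarrow> nat" where
  "weight r p = (\<Sum>v\<leftarrow>p. card (r\<^sup>* `` {v}))"

lemma weight_append: "weight r (p @ q) = weight r p + weight r q"
  by (simp add: weight_def)

definition minimal_walk :: "('v \<times> 'v) set \<Rightarrow> 'v set \<Rightarrow> 'v list \<Rightarrow> bool" where
  "minimal_walk r W p \<longleftrightarrow> open_walk r W p
     \<and> (\<forall>q. open_walk r W q \<and> hd q = hd p \<and> last q = last p \<longrightarrow> weight r p \<le> weight r q)"

lemma open_walk_nonempty: "open_walk r W p \<Longrightarrow> p \<noteq> []"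
  by auto

lemma minimal_walk_exists:
  assumes "open_walk r W p"
  obtains q where "minimal_walk r W q" "hd q = hd p" "last q = last p"
proof -
  let ?P = "\<lambda>q. open_walk r W q \<and> hd q = hd p \<and> last q = last p"
  obtain q where "?P q" "\<forall>q'. ?P q' \<longrightarrow> weight r q \<le> weight r q'"
    using ex_has_least_nat[of ?P p "weight r"] assms by auto
  with that[of q] show thesis by (simp add: minimal_walk_def)
qed

lemma minimal_walk_rev: 
  assumes "minimal_walk r W p" 
  shows "minimal_walk r W (rev p)"
  unfolding minimal_walk_def
proof (intro conjI allI impI)
  show "open_walk r W (rev p)"
    using assms by (simp add: minimal_walk_def open_walk_rev)
next
  fix q assume q: "open_walk r W q \<and> hd q = hd (rev p) \<and> last q = last (rev p)"
  then have "p \<noteq> []" "q \<noteq> []"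
    using assms open_walk_nonempty by (auto simp: minimal_walk_def)
  with q have "open_walk r W (rev q)" "hd (rev q) = hd p" "last (rev q) = last p"
    by (auto simp: open_walk_rev hd_rev last_rev)
  then have "weight r p \<le> weight r (rev q)"
    using assms by (auto simp: minimal_walk_def)
  then show "weight r (rev p) \<le> weight r q"
    by (simp add: weight_def flip: rev_map)
qed

lemma card_reachable_pos: "finite r \<Longrightarrow> 0 < card (r\<^sup>* `` {v})"
  by (subst card_gt_0_iff) (auto simp: finite_rtrancl_Image)

lemma card_reachable_less:
  assumes "finite r" "acyclic r" "(v, w) \<in> r"
  shows "card (r\<^sup>* `` {w}) < card (r\<^sup>* `` {v})"
proof (rule psubset_card_mono)
  have "(w, v) \<notin> r\<^sup>*"
    using assms by (meson acyclic_def rtrancl_into_trancl2)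
  then have "v \<in> r\<^sup>* `` {v} - r\<^sup>* `` {w}"
    by auto
  moreover have "r\<^sup>* `` {w} \<subseteq> r\<^sup>* `` {v}"
    using assms(3) by (auto intro: converse_rtrancl_into_rtrancl)
  ultimately show "r\<^sup>* `` {w} \<subset> r\<^sup>* `` {v}" by blast
qed (use assms in \<open>simp add: finite_rtrancl_Image\<close>)

context
  fixes r :: "('v \<times> 'v) set" and W :: "'v set"
  assumes finite_r: "finite r" and acyclic_r: "acyclic r"
begin

lemma minimal_walk_no_shortcut:
  assumes "minimal_walk r W (xs @ ys @ zs)" "ys \<noteq> []" "open_walk r W (xs @ zs)"
    and "hd (xs @ zs) = hd (xs @ ys @ zs)" "last (xs @ zs) = last (xs @ ys @ zs)"
  shows False
proof -
  have "0 < weight r ys"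
    using assms(2) card_reachable_pos[OF finite_r] by (cases ys) (auto simp: weight_def)
  moreover have "weight r (xs @ ys @ zs) \<le> weight r (xs @ zs)"
    using assms by (auto simp: minimal_walk_def)
  ultimately show False by (simp add: weight_append)
qed

lemma minimal_walk_no_bypass:
  assumes "minimal_walk r W (xs @ u # v # w # ys)"
    and "open_walk r W (xs @ [u, w])" "open_walk r W (u # w # ys)"
  shows False
proof (rule minimal_walk_no_shortcut[of "xs @ [u]" "[v]" "w # ys"])
  show "open_walk r W ((xs @ [u]) @ w # ys)"
    using assms open_walk_append[of r W xs u w ys] by simp
qed (use assms(1) in \<open>auto simp: hd_append\<close>)

lemma open_walk_parts:
  assumes "open_walk r W (xs @ u # v # w # ys)"
  shows "open_walk r W (xs @ [u, v])" "open_walk r W (v # w # ys)" "linked r u v" "linked r v w"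
    "passable r W u v w"
  using assms open_walk_append[of r W xs u v "w # ys"] open_walk_Cons2[of r W v w ys] by auto

lemma open_walk_redirect_end:
  assumes "open_walk r W (xs @ [u, v])" "linked r u w"
    and "xs \<noteq> [] \<Longrightarrow> passable r W (last xs) u v \<Longrightarrow> linked r (last xs) u \<Longrightarrow> passable r W (last xs) u w"
  shows "open_walk r W (xs @ [u, w])"
proof -
  have "linked r (last xs) u" if "xs \<noteq> []"
    using that assms(1) open_walk_snoc2[of r W xs u v] open_walk_linked[of r W "butlast xs" "last xs" u]
    by (metis append.assoc append_Cons append_Nil append_butlast_last_id)
  with assms show ?thesis by (simp add: open_walk_snoc2)
qed

lemma open_walk_redirect_start:
  assumes "open_walk r W (v # w # ys)" "linked r u w"
    and "ys \<noteq> [] \<Longrightarrow> passable r W v w (hd ys) \<Longrightarrow> passable r W u w (hd ys)"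
  shows "open_walk r W (u # w # ys)"
  using assms by (cases ys) (auto simp: open_walk_Cons2)

text \<open>For \<open>u \<rightarrow> v \<leftarrow> w\<close> with \<open>u \<rightarrow> w\<close>, skipping \<open>v\<close> leaves an open walk: \<open>u\<close> keeps an outgoing
  edge, and if \<open>w\<close> becomes a collider, then it is open because it is a parent of \<open>v\<close>.\<close>

lemma minimal_walk_collider_unlinked:
  assumes min: "minimal_walk r W (xs @ u # v # w # ys)" and uv: "(u, v) \<in> r" and wv: "(w, v) \<in> r"
  shows "(u, w) \<notin> r"
proof
  assume uw: "(u, w) \<in> r"
  have "open_walk r W (xs @ u # v # w # ys)"
    using min by (simp add: minimal_walk_def)
  note parts = open_walk_parts[OF this]
  have "v \<in> anc r W"
    using parts(5) uv wv by (simp add: passable_def)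
  then have "w \<in> anc r W"
    using wv anc_step by metis
  show False
  proof (rule minimal_walk_no_bypass[OF min])
    show "open_walk r W (xs @ [u, w])"
      using open_walk_redirect_end[OF parts(1)] uv uw passable_out[OF acyclic_r] by metis
    show "open_walk r W (u # w # ys)"
    proof (rule open_walk_redirect_start[OF parts(2)])
      assume "passable r W v w (hd ys)"
      then have "w \<notin> W"
        using passable_out[OF acyclic_r, of w v "hd ys" W] wv by simp
      then show "passable r W u w (hd ys)"
        using \<open>w \<in> anc r W\<close> by (simp add: passable_def)
    qed (use uw in simp)
  qed
qed

text \<open>Skipping the non-collider \<open>v\<close> in a triangle with \<open>u \<rightarrow> w\<close> can fail to give an open walk only if
  \<open>u\<close> changes from a collider to a non-collider, which needs \<open>v \<rightarrow> u\<close> and an edge into \<open>u\<close> from the left.\<close>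

lemma minimal_walk_shielded_aux:
  assumes min: "minimal_walk r W (xs @ u # v # w # ys)" and uw: "(u, w) \<in> r"
    and nc: "\<not> ((u, v) \<in> r \<and> (w, v) \<in> r)"
  shows "(v, u) \<in> r \<and> (v, w) \<in> r \<and> xs \<noteq> [] \<and> (last xs, u) \<in> r"
proof -
  have "open_walk r W (xs @ u # v # w # ys)"
    using min by (simp add: minimal_walk_def)
  note parts = open_walk_parts[OF this]
  have right: "open_walk r W (u # w # ys)" if "(v, w) \<in> r"
    using open_walk_redirect_start[OF parts(2)] that uw by (auto simp: passable_def)
  have no_left: "\<not> open_walk r W (xs @ [u, w])" if "(v, w) \<in> r"
    using minimal_walk_no_bypass[OF min] right[OF that] by blast
  have "(v, u) \<in> r"
  proof (rule ccontr)
    assume "(v, u) \<notin> r"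
    then have "(u, v) \<in> r" "(v, w) \<in> r"
      using parts nc by auto
    then have "open_walk r W (xs @ [u, w])"
      using open_walk_redirect_end[OF parts(1)] uw passable_out[OF acyclic_r] by metis
    with no_left \<open>(v, w) \<in> r\<close> show False by blast
  qed
  moreover from this uw have "(w, v) \<notin> r"
    using acyclic_r by (meson acyclic_def r_into_trancl trancl_into_trancl)
  then have "(v, w) \<in> r"
    using parts by auto
  moreover from no_left[OF this] have "xs \<noteq> [] \<and> (last xs, u) \<in> r"
    using open_walk_redirect_end[OF parts(1)] uw passable_out[OF acyclic_r] by metis
  ultimately show ?thesis by blast
qed

text \<open>A walk that starts along an edge out of \<open>v\<close> either stays directed to its end or meets a collider
  that is a descendant of \<open>v\<close>; in the latter case \<open>v\<close> itself is an ancestor of \<open>W\<close>.\<close>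

lemma open_walk_directed_start:
  assumes "open_walk r W (v # u # ys)" "(v, u) \<in> r" "v \<notin> anc r W"
  shows "(v, last (u # ys)) \<in> r\<^sup>+"
  using assms
proof (induction ys arbitrary: v u)
  case (Cons y ys)
  have "(y, u) \<notin> r"
    using Cons.prems anc_step[of v u r W] by (auto simp: passable_def)
  then have "(u, y) \<in> r"
    using Cons.prems by (auto simp: open_walk_Cons2)
  moreover have "u \<notin> anc r W"
    using Cons.prems anc_step by metis
  ultimately have "(u, last (y # ys)) \<in> r\<^sup>+"
    using Cons.IH[of u y] Cons.prems by simp
  with Cons.prems(2) show ?case by auto
qed auto

text \<open>If \<open>v\<close> turns into a collider, the loop leaves \<open>v\<close> by an outgoing edge and, as the graph is acyclic,
  reaches a collider below \<open>v\<close>; so \<open>v\<close> is an ancestor of \<open>W\<close>.\<close>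

lemma open_walk_loop_erase:
  assumes op: "open_walk r W (xs @ v # ys @ v # zs)" 
  shows "open_walk r W (xs @ v # zs)"
proof -
  have 1: "open_walk r W (xs @ [v])" "open_walk r W (v # ys @ v # zs)"
    using op open_walk_join[of r W xs v "ys @ v # zs"] by auto
  then have 2: "open_walk r W (v # ys @ [v])" "open_walk r W (v # zs)"
    using open_walk_join[of r W "v # ys" v zs] by auto
  then have "ys \<noteq> []"
    using acyclic_asym[OF acyclic_r, of v v] by auto
  then obtain l r' ys1 ys2 where ys: "ys = l # ys1" "ys = ys2 @ [r']"
    by (metis neq_Nil_conv rev_exhaust)
  have "passable r W (last xs) v (hd zs)" if "xs \<noteq> []" "zs \<noteq> []"
  proof -
    let ?x = "last xs" and ?y = "hd zs"
    have px: "passable r W ?x v l"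
      using that op open_walk_join[of r W xs v "ys @ v # zs"] ys(1) by simp
    have py: "passable r W r' v ?y"
      using that 1 open_walk_join[of r W "v # ys" v zs] ys(2) by simp
    have lv: "linked r v l"
      using 2(1) ys(1) open_walk_Cons2[of r W v l "ys1 @ [v]"] by simp
    have "v \<in> anc r W" if xy: "(?x, v) \<in> r" "(?y, v) \<in> r"
    proof (rule ccontr)
      assume v: "v \<notin> anc r W"
      then have "(l, v) \<notin> r"
        using px xy by (auto simp: passable_def)
      then have "(v, l) \<in> r" using lv by blast
      then have "(v, v) \<in> r\<^sup>+"
        using open_walk_directed_start[of v l "ys1 @ [v]"] 2(1) v ys(1) by simp
      then show False
        using acyclic_r by (simp add: acyclic_def)
    qed
    moreover have "v \<notin> W" if "\<not> ((?x, v) \<in> r \<and> (?y, v) \<in> r)"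
      using that px py by (auto simp: passable_def split: if_splits)
    ultimately show ?thesis
      by (simp add: passable_def)
  qed
  with 1 2 show ?thesis
    using open_walk_join[of r W xs v zs] by blast
qed

lemma minimal_walk_distinct:
  assumes "minimal_walk r W p"
  shows "distinct p"
proof (rule ccontr)
  assume "\<not> distinct p"
  then obtain xs v ys zs where p: "p = xs @ v # ys @ v # zs"
    using not_distinct_decomp[of p] by auto
  show False
  proof (rule minimal_walk_no_shortcut[of "xs @ [v]" "ys @ [v]" zs])
    show "open_walk r W ((xs @ [v]) @ zs)"
      using open_walk_loop_erase[of xs v ys zs] assms p by (simp add: minimal_walk_def)
  qed (use assms p in \<open>auto simp: hd_append\<close>)
qed

lemma minimal_walk_collider_unshielded:
  assumes min: "minimal_walk r W (xs @ u # v # w # ys)" and uv: "(u, v) \<in> r" and wv: "(w, v) \<in> r"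
  shows "\<not> linked r u w \<and> u \<noteq> w"
proof -
  have "minimal_walk r W (rev ys @ w # v # u # rev xs)"
    using minimal_walk_rev[OF min] by simp
  then show ?thesis
    using minimal_walk_collider_unlinked[OF min uv wv] minimal_walk_distinct[OF min]
      minimal_walk_collider_unlinked[of "rev ys" w v u "rev xs"] uv wv by auto
qed

text \<open>The shielded non-collider \<open>v\<close> is a fork, one of whose neighbours \<open>y\<close> is a collider of the walk. As
  colliders of a minimal walk are unshielded, \<open>v \<rightarrow> y\<close> takes part in a v-structure, so its direction is
  shared by all graphs with the same v-structures.\<close>

lemma minimal_walk_shielded_noncollider:
  assumes min: "minimal_walk r W (xs @ u # v # w # ys)" and uw: "linked r u w"
    and nc: "\<not> ((u, v) \<in> r \<and> (w, v) \<in> r)"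
  shows "\<exists>x y. y \<in> {u, w} \<and> (v, y) \<in> r \<and> (x, y) \<in> r \<and> x \<noteq> v \<and> \<not> linked r x v"
proof -
  have main: ?thesis if min': "minimal_walk r W (xs' @ u' # v # w' # ys')" and uw': "(u', w') \<in> r"
    and nc': "\<not> ((u', v) \<in> r \<and> (w', v) \<in> r)" and eq: "{u', w'} = {u, w}" for xs' u' w' ys'
  proof -
    have *: "(v, u') \<in> r" "xs' \<noteq> []" "(last xs', u') \<in> r"
      using minimal_walk_shielded_aux[OF min' uw' nc'] by auto
    then obtain zs x where xs': "xs' = zs @ [x]"
      by (cases xs' rule: rev_cases) auto
    have "\<not> linked r x v \<and> x \<noteq> v"
      using minimal_walk_collider_unshielded[of zs x u' v "w' # ys'"] min' xs' * by simp
    with * xs' eq show ?thesis by auto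
  qed
  have min': "minimal_walk r W (rev ys @ w # v # u # rev xs)"
    using minimal_walk_rev[OF min] by simp
  from uw show ?thesis
  proof
    assume "(u, w) \<in> r"
    then show ?thesis using main[OF min] nc by blast
  next
    assume "(w, u) \<in> r"
    then show ?thesis using main[OF min'] nc by blast
  qed
qed

text \<open>Otherwise \<open>d\<close> could take the place of the collider \<open>c\<close> on the walk, and \<open>d\<close> has fewer descendants.\<close>

lemma minimal_walk_collider_child:
  assumes min: "minimal_walk r W (xs @ u # c # w # ys)" and uc: "(u, c) \<in> r" and wc: "(w, c) \<in> r"
    and cd: "(c, d) \<in> r" and d: "d \<in> anc r W"
  shows "\<not> linked r u d \<or> \<not> linked r w d"
proof (rule ccontr)
  assume "\<not> ?thesis"
  then have "linked r u d" "linked r w d" by auto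
  moreover have "(d, x) \<notin> r" if "(x, c) \<in> r" for x
    using that cd acyclic_r by (meson acyclic_def r_into_trancl trancl_into_trancl)
  ultimately have ud: "(u, d) \<in> r" and wd: "(w, d) \<in> r"
    using uc wc by auto
  have op: "open_walk r W (xs @ u # c # w # ys)"
    using min by (simp add: minimal_walk_def)
  note parts = open_walk_parts[OF op]
  have "open_walk r W (xs @ [u, d])"
    using open_walk_redirect_end[OF parts(1)] uc ud passable_out[OF acyclic_r] by metis
  moreover have "open_walk r W (d # w # ys)"
    using open_walk_redirect_start[OF parts(2), of d] wc wd passable_out[OF acyclic_r] by metis
  moreover have "passable r W u d w"
    using ud wd d by (simp add: passable_def)
  ultimately have "open_walk r W (xs @ u # d # w # ys)"
    using ud open_walk_append[of r W xs u d "w # ys"] by simp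
  moreover have "hd (xs @ u # d # w # ys) = hd (xs @ u # c # w # ys)"
    by (cases xs) auto
  ultimately have "weight r (xs @ u # c # w # ys) \<le> weight r (xs @ u # d # w # ys)"
    using min by (simp add: minimal_walk_def)
  with card_reachable_less[OF finite_r acyclic_r cd] show False
    by (simp add: weight_def)
qed

end

section \<open>Separation in a maximal PDAG and in a represented DAG\<close>

lemma causal_Cons_Cons: "causal G (u # v # p) \<longleftrightarrow> (u, v) \<in> dir G \<and> causal G (v # p)"
proof -
  have "(\<forall>i. P i) \<longleftrightarrow> P 0 \<and> (\<forall>i. P (Suc i))" for P :: "nat \<Rightarrow> bool"
    by (metis not0_implies_Suc)
  from this[of "\<lambda>i. Suc i < length (u # v # p) \<longrightarrow> ((u # v # p) ! i, (u # v # p) ! Suc i) \<in> dir G"]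
  show ?thesis by (simp add: causal_def)
qed

lemma causal_reaches: "causal G p \<Longrightarrow> p \<noteq> [] \<Longrightarrow> x \<in> set p \<Longrightarrow> (hd p, x) \<in> (dir G)\<^sup>*"
proof (induction p)
  case (Cons u p)
  show ?case
  proof (cases p)
    case (Cons v q)
    then have "(u, v) \<in> dir G" "causal G p"
      using Cons.prems(1) by (auto simp: causal_Cons_Cons)
    with Cons Cons.IH Cons.prems(3) show ?thesis
      by (auto intro: converse_rtrancl_into_rtrancl)
  qed (use Cons.prems in auto)
qed auto

lemma de_eq:
  assumes "pdag G" "c \<in> nodes G"
  shows "de G c = (dir G)\<^sup>* `` {c}"
proof (intro set_eqI iffI)
  fix w assume "w \<in> de G c"
  then obtain p where p: "path_from_to G {c} {w} p" "causal G p"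
    by (auto simp: de_def)
  then have "p \<noteq> []" "hd p = c" "last p = w"
    by (auto simp: path_from_to_def is_path_def)
  then show "w \<in> (dir G)\<^sup>* `` {c}"
    using causal_reaches[OF p(2), of w] by auto
next
  have acyc: "acyclic (dir G)" and sub: "dir G \<subseteq> nodes G \<times> nodes G"
    using assms by (auto simp: pdag_def simple_graph_def)
  fix w assume "w \<in> (dir G)\<^sup>* `` {c}"
  then have "(c, w) \<in> (dir G)\<^sup>*" by auto
  then have "\<exists>p. path_from_to G {c} {w} p \<and> causal G p"
    using assms(2)
  proof (induction rule: converse_rtrancl_induct)
    case base
    then show ?case
      by (intro exI[of _ "[w]"]) (auto simp: path_from_to_def is_path_def causal_def)
  next
    case (step c d)
    then have "d \<in> nodes G" using sub by auto
    with step obtain p where p: "path_from_to G {d} {w} p" "causal G p" by blast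
    then obtain q where q: "p = d # q"
      by (cases p) (auto simp: path_from_to_def is_path_def)
    have "c \<notin> set p"
    proof
      assume "c \<in> set p"
      then have "(d, c) \<in> (dir G)\<^sup>*"
        using causal_reaches[OF p(2), of c] q by auto
      with step(1) acyc show False
        by (meson acyclic_def rtrancl_into_trancl2)
    qed
    moreover have "adj G ((c # p) ! i) ((c # p) ! Suc i)" if "Suc i < length (c # p)" for i
      using that p q step(1) by (cases i) (auto simp: path_from_to_def is_path_def adj_def)
    ultimately have "path_from_to G {c} {w} (c # p)"
      using p(1) q step.prems by (auto simp: path_from_to_def is_path_def)
    moreover have "causal G (c # p)"
      using p(2) q step(1) by (simp add: causal_Cons_Cons)
    ultimately show ?case by blast
  qed
  then show "w \<in> de G c" by (simp add: de_def)
qed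

lemma split_at_interior:
  assumes "0 < i" "Suc i < length p"
  shows "p = take (i - 1) p @ p ! (i - 1) # p ! i # p ! Suc i # drop (Suc (Suc i)) p"
proof -
  obtain j where "i = Suc j" using assms(1) gr0_implies_Suc by blast
  with assms(2) show ?thesis
    by (simp add: Cons_nth_drop_Suc id_take_nth_drop[symmetric])
qed

context
  fixes G D :: "'v pgraph"
  assumes maxG: "maximal_pdag G" and DG: "D \<in> represented_dags G"
begin

lemma pdag_G: "pdag G"
  using maxG by (simp add: maximal_pdag_def)

lemma acyclic_dir_D: "acyclic (dir D)"
  using DG by (auto simp: represented_dags_def dag_def pdag_def)

lemma finite_dir_D: "finite (dir D)"
proof -
  have "finite (nodes D)" "dir D \<subseteq> nodes D \<times> nodes D"
    using DG by (auto simp: represented_dags_def dag_def pdag_def simple_graph_def)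
  then show ?thesis by (meson finite_SigmaI finite_subset)
qed

lemma linked_dir_D: "linked (dir D) u v \<longleftrightarrow> adj G u v"
  using DG by (auto simp: represented_dags_def dag_def adj_def)

lemma dir_D_nodes: "dir D \<subseteq> nodes G \<times> nodes G"
  using DG by (auto simp: represented_dags_def dag_def pdag_def simple_graph_def)

lemma dir_G_subset: "dir G \<subseteq> dir D"
  using DG by (auto simp: represented_dags_def)

lemma v_structure_directed:
  assumes "(u, v) \<in> dir D" "(w, v) \<in> dir D" "u \<noteq> w" "\<not> linked (dir D) u w"
  shows "(u, v) \<in> dir G" "(w, v) \<in> dir G"
proof -
  have "(u, v, w) \<in> v_structures D"
    using assms linked_dir_D[of u w] DG by (auto simp: v_structures_def represented_dags_def)
  then have "(u, v, w) \<in> v_structures G"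
    using DG by (auto simp: represented_dags_def)
  then show "(u, v) \<in> dir G" "(w, v) \<in> dir G"
    by (auto simp: v_structures_def)
qed

lemma und_sym: "(u, v) \<in> und G \<Longrightarrow> (v, u) \<in> und G"
  using pdag_G by (auto simp: pdag_def simple_graph_def sym_def)

lemma und_not_dir: "(u, v) \<in> und G \<Longrightarrow> (u, v) \<notin> dir G"
  using pdag_G by (auto simp: pdag_def simple_graph_def)

lemma no_orphan_undirected:
  "(a, b) \<in> dir G \<Longrightarrow> (b, c) \<in> und G \<Longrightarrow> a \<noteq> c \<Longrightarrow> adj G a c"
  using maxG unfolding maximal_pdag_def by blast

text \<open>The edge is oriented in \<open>G\<close>, because \<open>x \<rightarrow> c - d\<close> with \<open>x, d\<close> non-adjacent is forbidden there.\<close>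

lemma orientation_propagates:
  assumes xc: "(x, c) \<in> dir G" and cd: "(c, d) \<in> dir D" and xd: "\<not> linked (dir D) x d"
  shows "(c, d) \<in> dir G"
proof -
  have "x \<noteq> d"
    using acyclic_asym[OF acyclic_dir_D cd] xc dir_G_subset by auto
  have "adj G c d" using cd linked_dir_D by auto
  moreover have "(d, c) \<notin> dir G"
    using acyclic_asym[OF acyclic_dir_D cd] dir_G_subset by auto
  moreover have "(c, d) \<notin> und G"
    using no_orphan_undirected[OF xc _ \<open>x \<noteq> d\<close>] xd linked_dir_D by auto
  ultimately show ?thesis by (auto simp: adj_def)
qed

lemma non_collider_not_collider:
  assumes "is_path G p" "non_collider_at G p i"
  shows "\<not> ((p ! (i - 1), p ! i) \<in> dir D \<and> (p ! Suc i, p ! i) \<in> dir D)"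
proof
  assume col: "(p ! (i - 1), p ! i) \<in> dir D \<and> (p ! Suc i, p ! i) \<in> dir D"
  then have "(p ! i, p ! (i - 1)) \<notin> dir G" "(p ! i, p ! Suc i) \<notin> dir G"
    using acyclic_asym[OF acyclic_dir_D] dir_G_subset by auto
  with assms have u: "(p ! (i - 1), p ! i) \<in> und G" "\<not> adj G (p ! (i - 1)) (p ! Suc i)"
    and i: "0 < i" "Suc i < length p"
    by (auto simp: non_collider_at_def)
  have "p ! (i - 1) \<noteq> p ! Suc i"
    using i assms(1) by (auto simp: is_path_def nth_eq_iff_index_eq)
  with u col have "(p ! (i - 1), p ! i) \<in> dir G"
    using v_structure_directed(1) linked_dir_D by blast
  with u und_not_dir show False by blast
qed

lemma anc_if_de:
  assumes "c \<in> nodes G" "de G c \<inter> W \<noteq> {}"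
  shows "c \<in> anc (dir D) W"
  using assms de_eq[OF pdag_G assms(1)] rtrancl_mono[OF dir_G_subset] by (auto simp: anc_def)

lemma open_path_is_open_walk:
  assumes p: "is_path G p" and ds: "definite_status G p" and open_p: "\<not> blocked G W p"
  shows "open_walk (dir D) W p"
  unfolding open_walk_nth
proof (intro conjI allI impI)
  show "p \<noteq> []" using p by (simp add: is_path_def)
next
  fix i assume "Suc i < length p"
  then show "linked (dir D) (p ! i) (p ! Suc i)"
    using p by (simp add: is_path_def linked_dir_D)
next
  fix i assume i: "0 < i \<and> Suc i < length p"
  then consider "collider_at G p i" | "non_collider_at G p i"
    using ds by (auto simp: definite_status_def)
  then show "passable (dir D) W (p ! (i - 1)) (p ! i) (p ! Suc i)"
  proof cases
    case 1
    have "p ! i \<in> nodes G"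
      using p i by (auto simp: is_path_def)
    moreover have "de G (p ! i) \<inter> W \<noteq> {}"
      using 1 open_p by (auto simp: blocked_def)
    ultimately show ?thesis
      using 1 anc_if_de dir_G_subset by (auto simp: passable_def collider_at_def)
  next
    case 2
    have "p ! i \<notin> W" using 2 open_p by (auto simp: blocked_def)
    with non_collider_not_collider[OF p 2] show ?thesis unfolding passable_def by presburger
  qed
qed

text \<open>Along a shortest directed path to \<open>W\<close>, nodes at distance two are non-adjacent, so the orientation of
  the first edge in \<open>G\<close> propagates to all later ones. The last assumption says that going through
  \<open>c\<close> is a shortest way from \<open>x\<close> to \<open>W\<close>.\<close>

lemma shortest_directed_path_in_G:
  assumes "(x, c) \<in> dir G" "\<exists>w\<in>W. (c, w) \<in> dir D ^^ n"
    and "\<forall>m\<le>n. \<not> (\<exists>w\<in>W. (x, w) \<in> dir D ^^ m)"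
  shows "\<exists>w\<in>W. (c, w) \<in> (dir G)\<^sup>*"
  using assms
proof (induction n arbitrary: x c)
  case (Suc n)
  then obtain d w where d: "(c, d) \<in> dir D" "(d, w) \<in> dir D ^^ n" "w \<in> W"
    by (meson relpow_Suc_D2)
  have "(x, d) \<notin> dir D"
    using d Suc.prems(3) relpow_Suc_I2[of x d "dir D" w n] by auto
  moreover have "(d, x) \<notin> dir D"
    using d(1) Suc.prems(1) dir_G_subset acyclic_dir_D
    by (meson acyclic_def r_into_trancl subsetD trancl_into_trancl)
  ultimately have cd: "(c, d) \<in> dir G"
    using orientation_propagates[OF Suc.prems(1) d(1)] by blast
  moreover have "\<not> (\<exists>w\<in>W. (c, w) \<in> dir D ^^ m)" if "m \<le> n" for m
  proof
    assume "\<exists>w\<in>W. (c, w) \<in> dir D ^^ m"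
    then have "\<exists>w\<in>W. (x, w) \<in> dir D ^^ Suc m"
      using Suc.prems(1) dir_G_subset relpow_Suc_I2 by (metis subsetD)
    with Suc.prems(3) that show False
      by (metis Suc_le_mono)
  qed
  ultimately have "\<exists>w\<in>W. (d, w) \<in> (dir G)\<^sup>*"
    using Suc.IH d by blast
  with cd show ?case by (meson converse_rtrancl_into_rtrancl)
qed auto

text \<open>Colliders are unshielded, hence v-structures. An unshielded non-collider has definite status in \<open>G\<close>
  because a half-directed unshielded triple \<open>u \<rightarrow> v - w\<close> is forbidden; a shielded one because of
  \<open>minimal_walk_shielded_noncollider\<close>. For the descendants of a collider \<open>c\<close>, its first step \<open>c \<rightarrow> d\<close>
  towards \<open>W\<close> is directed in \<open>G\<close>, since \<open>d\<close> is not adjacent to both neighbours of \<open>c\<close> on the walk.\<close>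

lemma minimal_walk_is_open_path:
  assumes min: "minimal_walk (dir D) W p" and hd: "hd p \<in> nodes G"
  shows "is_path G p" "definite_status G p" "\<not> blocked G W p"
proof -
  note ctxt = finite_dir_D acyclic_dir_D
  have op: "open_walk (dir D) W p" using min by (simp add: minimal_walk_def)
  then have ne: "p \<noteq> []" and lnk: "\<And>i. Suc i < length p \<Longrightarrow> linked (dir D) (p ! i) (p ! Suc i)"
    and pass: "\<And>i. 0 < i \<Longrightarrow> Suc i < length p \<Longrightarrow>
      passable (dir D) W (p ! (i - 1)) (p ! i) (p ! Suc i)"
    by (auto simp: open_walk_nth)
  have "p ! i \<in> nodes G" if "i < length p" for i
    using that
  proof (cases i)
    case 0
    with hd ne show ?thesis by (simp add: hd_conv_nth)
  next
    case (Suc j)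
    with that lnk[of j] dir_D_nodes show ?thesis by auto
  qed
  then have nodes: "set p \<subseteq> nodes G"
    by (auto simp: in_set_conv_nth)
  with ne lnk minimal_walk_distinct[OF ctxt min] show path: "is_path G p"
    by (simp add: is_path_def linked_dir_D)

  have unshielded: "(p ! (i - 1), p ! i) \<in> dir G \<and> (p ! Suc i, p ! i) \<in> dir G"
    if i: "0 < i" "Suc i < length p"
      and col: "(p ! (i - 1), p ! i) \<in> dir D" "(p ! Suc i, p ! i) \<in> dir D" for i
  proof -
    have "minimal_walk (dir D) W
        (take (i - 1) p @ p ! (i - 1) # p ! i # p ! Suc i # drop (Suc (Suc i)) p)"
      using min split_at_interior[OF i] by simp
    from minimal_walk_collider_unshielded[OF ctxt this col] v_structure_directed[OF col]
    show ?thesis by blast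
  qed
  have status: "if (p ! (i - 1), p ! i) \<in> dir D \<and> (p ! Suc i, p ! i) \<in> dir D
      then collider_at G p i else non_collider_at G p i"
    if i: "0 < i" "Suc i < length p" for i
  proof -
    let ?u = "p ! (i - 1)" and ?v = "p ! i" and ?w = "p ! Suc i"
    have ne: "?u \<noteq> ?w"
      using i path by (auto simp: is_path_def nth_eq_iff_index_eq)
    have a: "adj G ?u ?v" "adj G ?v ?w"
      using i path by (auto simp: is_path_def dest!: spec[of _ "i - 1"])
    have "non_collider_at G p i" if nc: "\<not> ((?u, ?v) \<in> dir D \<and> (?w, ?v) \<in> dir D)"
    proof (cases "linked (dir D) ?u ?w")
      case True
      have min': "minimal_walk (dir D) W
          (take (i - 1) p @ ?u # ?v # ?w # drop (Suc (Suc i)) p)"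
        using min split_at_interior[OF i] by simp
      obtain x y where "y \<in> {?u, ?w}" "(?v, y) \<in> dir D" "(x, y) \<in> dir D" "x \<noteq> ?v"
        "\<not> linked (dir D) x ?v"
        using minimal_walk_shielded_noncollider[OF ctxt min' True nc] by blast
      then have "y \<in> {?u, ?w}" "(?v, y) \<in> dir G"
        using v_structure_directed by blast+
      then show ?thesis
        using i by (auto simp: non_collider_at_def)
    next
      case False
      then have "\<not> adj G ?u ?w" "\<not> adj G ?w ?u" using linked_dir_D by blast+
      then have "(?u, ?v) \<in> dir G \<Longrightarrow> (?v, ?w) \<notin> und G" "(?w, ?v) \<in> dir G \<Longrightarrow> (?v, ?u) \<notin> und G"
        using no_orphan_undirected ne by metis+
      with a nc dir_G_subset und_sym False \<open>\<not> adj G ?u ?w\<close> i show ?thesis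
        by (auto simp: non_collider_at_def adj_def)
    qed
    then show ?thesis
      using unshielded[OF i] i by (simp add: collider_at_def)
  qed
  then show "definite_status G p"
    unfolding definite_status_def by meson

  show "\<not> blocked G W p"
  proof
    assume "blocked G W p"
    then consider i where "non_collider_at G p i" "p ! i \<in> W"
      | i where "collider_at G p i" "de G (p ! i) \<inter> W = {}"
      by (auto simp: blocked_def)
    then show False
    proof cases
      case 1
      then show ?thesis
        using non_collider_not_collider[OF path 1(1)] pass[of i]
        by (auto simp: non_collider_at_def passable_def)
    next
      case 2
      let ?u = "p ! (i - 1)" and ?c = "p ! i" and ?w = "p ! Suc i"
      have i: "0 < i" "Suc i < length p" and ucw: "(?u, ?c) \<in> dir G" "(?w, ?c) \<in> dir G"
        using 2 by (auto simp: collider_at_def)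
      then have ucw': "(?u, ?c) \<in> dir D" "(?w, ?c) \<in> dir D"
        using dir_G_subset by auto
      have min': "minimal_walk (dir D) W
          (take (i - 1) p @ ?u # ?c # ?w # drop (Suc (Suc i)) p)"
        using min split_at_interior[OF i] by simp
      have "\<exists>w\<in>W. (?c, w) \<in> (dir D)\<^sup>*"
        using pass[OF i] ucw' by (simp add: passable_def anc_def)
      then have ex: "\<exists>n. \<exists>w\<in>W. (?c, w) \<in> dir D ^^ n"
        by (meson rtrancl_imp_relpow)
      define n where "n = (LEAST n. \<exists>w\<in>W. (?c, w) \<in> dir D ^^ n)"
      have n: "\<exists>w\<in>W. (?c, w) \<in> dir D ^^ n"
        unfolding n_def by (rule LeastI_ex[OF ex])
      have least: "\<not> (\<exists>w\<in>W. (?c, w) \<in> dir D ^^ m)" if "m < n" for m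
        using not_less_Least that unfolding n_def by blast
      have "\<exists>w\<in>W. (?c, w) \<in> (dir G)\<^sup>*"
      proof (cases n)
        case 0
        with n show ?thesis by auto
      next
        case (Suc k)
        with n obtain d w where d: "(?c, d) \<in> dir D" "(d, w) \<in> dir D ^^ k" "w \<in> W"
          by (meson relpow_Suc_D2)
        then have "d \<in> anc (dir D) W"
          by (auto simp: anc_def dest: relpow_imp_rtrancl)
        then have "\<not> linked (dir D) ?u d \<or> \<not> linked (dir D) ?w d"
          using minimal_walk_collider_child[OF ctxt min' ucw' d(1)] by blast
        then have "(?c, d) \<in> dir G"
          using orientation_propagates[OF ucw(1) d(1)] orientation_propagates[OF ucw(2) d(1)] by blast
        moreover from this have "\<exists>w\<in>W. (d, w) \<in> (dir G)\<^sup>*"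
          using shortest_directed_path_in_G[of ?c d W k] d least Suc by auto
        ultimately show ?thesis
          by (meson converse_rtrancl_into_rtrancl)
      qed
      moreover have "?c \<in> nodes G" using nodes i by auto
      ultimately show False
        using 2(2) de_eq[OF pdag_G] by auto
    qed
  qed
qed

theorem dsep_iff_walk_sep:
  assumes "A \<subseteq> nodes G"
  shows "dsep G A B W \<longleftrightarrow> walk_sep (dir D) A B W"
proof
  assume sep: "dsep G A B W"
  show "walk_sep (dir D) A B W"
    unfolding walk_sep_def
  proof
    assume "\<exists>p. open_walk (dir D) W p \<and> hd p \<in> A \<and> last p \<in> B"
    then obtain p where "open_walk (dir D) W p" "hd p \<in> A" "last p \<in> B" by blast
    then obtain q where q: "minimal_walk (dir D) W q" "hd q \<in> A" "last q \<in> B"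
      by (metis minimal_walk_exists)
    with assms have "hd q \<in> nodes G" by blast
    from minimal_walk_is_open_path[OF q(1) this] q sep show False
      by (auto simp: dsep_def path_from_to_def)
  qed
next
  assume sep: "walk_sep (dir D) A B W"
  show "dsep G A B W"
    unfolding dsep_def
  proof (intro allI impI, rule ccontr)
    fix p assume "path_from_to G A B p \<and> definite_status G p" "\<not> blocked G W p"
    with open_path_is_open_walk[of p W] sep show False
      by (auto simp: walk_sep_def path_from_to_def)
  qed
qed

end

section \<open>Residuals and partial covariances\<close>

text \<open>A function \<open>c\<close> stands for the linear combination of the variables with coefficients \<open>c i\<close>;
  \<open>form N S c d\<close> is then the covariance of two such combinations. Working with coefficients makes the
  subspace spanned by some of the variables a condition on the support.\<close>

definition form :: "'v set \<Rightarrow> ('v \<Rightarrow> 'v \<Rightarrow> real) \<Rightarrow> ('v \<Rightarrow> real) \<Rightarrow> ('v \<Rightarrow> real) \<Rightarrow> real" where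
  "form N S c d = (\<Sum>i\<in>N. \<Sum>j\<in>N. c i * d j * S i j)"

definition positive_definite_on :: "'v set \<Rightarrow> ('v \<Rightarrow> 'v \<Rightarrow> real) \<Rightarrow> bool" where
  "positive_definite_on N S \<longleftrightarrow> finite N \<and> (\<forall>i\<in>N. \<forall>j\<in>N. S i j = S j i)
     \<and> (\<forall>c. 0 \<le> form N S c c \<and> (form N S c c = 0 \<longrightarrow> (\<forall>i\<in>N. c i = 0)))"

definition unit :: "'v \<Rightarrow> 'v \<Rightarrow> real" where
  "unit s i = (if i = s then 1 else 0)"

text \<open>\<open>r\<close> is the coefficient vector of \<open>s\<close> minus its least squares projection onto the variables in \<open>T\<close>.\<close>

definition residual :: "'v set \<Rightarrow> ('v \<Rightarrow> 'v \<Rightarrow> real) \<Rightarrow> 'v set \<Rightarrow> 'v \<Rightarrow> ('v \<Rightarrow> real) \<Rightarrow> bool" where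
  "residual N S T s r \<longleftrightarrow> (\<forall>i\<in>N - T. r i = unit s i) \<and> (\<forall>t\<in>T. form N S r (unit t) = 0)"

lemma sum_unit_right: "finite N \<Longrightarrow> s \<in> N \<Longrightarrow> (\<Sum>j\<in>N. f j * unit s j) = f s"
  by (simp add: unit_def if_distrib sum.delta cong: if_cong)

lemma sum_unit_mult: "finite N \<Longrightarrow> s \<in> N \<Longrightarrow> (\<Sum>j\<in>N. unit s j * f j) = f s"
  using sum_unit_right[of N s f] by (simp add: mult.commute)

lemma form_cong:
  "(\<And>i. i \<in> N \<Longrightarrow> c i = c' i) \<Longrightarrow> (\<And>i. i \<in> N \<Longrightarrow> d i = d' i) \<Longrightarrow> form N S c d = form N S c' d'"
  by (simp add: form_def cong: sum.cong)

lemma form_sum_left: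
  "form N S (\<lambda>i. \<Sum>k\<in>K. t k * e k i) d = (\<Sum>k\<in>K. t k * form N S (e k) d)"
proof -
  have "form N S (\<lambda>i. \<Sum>k\<in>K. t k * e k i) d
      = (\<Sum>i\<in>N. \<Sum>j\<in>N. \<Sum>k\<in>K. t k * (e k i * d j * S i j))"
    by (simp add: form_def sum_distrib_right mult.assoc)
  also have "\<dots> = (\<Sum>i\<in>N. \<Sum>k\<in>K. \<Sum>j\<in>N. t k * (e k i * d j * S i j))"
    by (intro sum.cong refl sum.swap)
  also have "\<dots> = (\<Sum>k\<in>K. \<Sum>i\<in>N. \<Sum>j\<in>N. t k * (e k i * d j * S i j))"
    by (rule sum.swap)
  finally show ?thesis by (simp add: form_def sum_distrib_left)
qed

lemma form_add_left: "form N S (\<lambda>i. c i + c' i) d = form N S c d + form N S c' d"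
  by (simp add: form_def algebra_simps sum.distrib)

lemma form_diff_left: "form N S (\<lambda>i. c i - c' i) d = form N S c d - form N S c' d"
  by (simp add: form_def algebra_simps sum_subtractf)

lemma form_scale_left: "form N S (\<lambda>i. a * c i) d = a * form N S c d"
  by (simp add: form_def sum_distrib_left mult.assoc)

lemma form_unit_right:
  assumes "finite N" "i \<in> N"
  shows "form N S c (unit i) = (\<Sum>j\<in>N. c j * S j i)"
proof -
  have "(\<Sum>j\<in>N. c k * unit i j * S k j) = c k * S k i" for k
    using sum_unit_right[OF assms, of "\<lambda>j. c k * S k j"] by (simp add: ac_simps)
  then show ?thesis by (simp add: form_def)
qed

context
  fixes N :: "'v set" and S :: "'v \<Rightarrow> 'v \<Rightarrow> real"
  assumes pd: "positive_definite_on N S"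
begin

lemma finite_N: "finite N"
  using pd by (simp add: positive_definite_on_def)

lemma form_commute: "form N S c d = form N S d c"
proof -
  have "form N S c d = (\<Sum>j\<in>N. \<Sum>i\<in>N. c i * d j * S i j)"
    unfolding form_def by (rule sum.swap)
  also have "\<dots> = form N S d c"
    unfolding form_def using pd
    by (intro sum.cong refl) (auto simp: positive_definite_on_def)
  finally show ?thesis .
qed

lemma form_nonneg: "0 \<le> form N S c c"
  using pd by (simp add: positive_definite_on_def)

lemma form_eq_0D: "form N S c c = 0 \<Longrightarrow> i \<in> N \<Longrightarrow> c i = 0"
  using pd by (simp add: positive_definite_on_def)

lemma form_supported:
  assumes "T \<subseteq> N" "\<And>i. i \<in> N - T \<Longrightarrow> d i = 0"
  shows "form N S c d = (\<Sum>i\<in>T. d i * form N S c (unit i))"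
proof -
  have "form N S c d = form N S (\<lambda>i. \<Sum>k\<in>T. d k * unit k i) c"
    unfolding form_commute[of c d]
  proof (rule form_cong)
    fix i assume i: "i \<in> N"
    have "(\<Sum>k\<in>T. d k * unit k i) = (\<Sum>k\<in>T. if k = i then d k else 0)"
      by (intro sum.cong) (auto simp: unit_def)
    also have "\<dots> = d i"
      using i assms finite_subset[OF assms(1) finite_N] by (cases "i \<in> T") auto
    finally show "d i = (\<Sum>k\<in>T. d k * unit k i)" by simp
  qed simp
  also have "\<dots> = (\<Sum>k\<in>T. d k * form N S c (unit k))"
    unfolding form_sum_left using form_commute by simp
  finally show ?thesis .
qed

lemma residual_orthogonal:
  assumes "residual N S T s r" "T \<subseteq> N" "\<And>i. i \<in> N - T \<Longrightarrow> d i = 0"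
  shows "form N S r d = 0"
  using assms(1) form_supported[OF assms(2,3)] by (simp add: residual_def)

lemma residual_form:
  assumes "residual N S T s r" "T \<subseteq> N" "\<And>i. i \<in> N - T \<Longrightarrow> d i = unit s' i"
  shows "form N S r (unit s') = form N S r d"
proof -
  have "form N S (\<lambda>i. d i - unit s' i) r = 0"
    using residual_orthogonal[OF assms(1,2), of "\<lambda>i. d i - unit s' i"] assms(3) form_commute by simp
  then show ?thesis by (simp add: form_diff_left form_commute[of r])
qed

lemma residual_form_self:
  assumes "residual N S T s r" "T \<subseteq> N"
  shows "form N S r (unit s) = form N S r r"
  using assms by (intro residual_form[OF assms]) (auto simp: residual_def)

lemma residual_pos:
  assumes "residual N S T s r" "s \<in> N" "s \<notin> T"
  shows "0 < form N S r r"
proof -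
  have "r s = 1" using assms by (auto simp: residual_def unit_def)
  then have "form N S r r \<noteq> 0" using form_eq_0D[of r s] assms(2) by auto
  with form_nonneg[of r] show ?thesis by linarith
qed

lemma residual_unique:
  assumes "residual N S T s r" "residual N S T s r'" "T \<subseteq> N" "i \<in> N"
  shows "r i = r' i"
proof -
  let ?d = "\<lambda>i. r i - r' i"
  have "?d i = 0" if "i \<in> N - T" for i
    using assms(1,2) that by (auto simp: residual_def)
  then have "form N S ?d ?d = 0"
    using residual_orthogonal[OF assms(1,3), of ?d] residual_orthogonal[OF assms(2,3), of ?d]
    by (simp add: form_diff_left)
  from form_eq_0D[OF this assms(4)] show ?thesis by simp
qed

text \<open>Gram-Schmidt: to add a regressor \<open>t\<close>, subtract a multiple of the residual of \<open>t\<close> itself.\<close>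

lemma residual_exists:
  assumes "T \<subseteq> N"
  shows "\<exists>r. residual N S T s r"
proof -
  have "finite T" using assms finite_N finite_subset by blast
  then show ?thesis
    using assms
  proof (induction T arbitrary: s rule: finite_induct)
    case empty
    then show ?case by (intro exI[of _ "unit s"]) (simp add: residual_def)
  next
    case (insert t T)
    then obtain r q where r: "residual N S T s r" and q: "residual N S T t q"
      by blast
    define a where "a = form N S r (unit t) / form N S q q"
    have "0 < form N S q q"
      using residual_pos[OF q] insert by auto
    then have "form N S (\<lambda>i. r i - a * q i) (unit t) = 0"
      using residual_form_self[OF q] insert.prems
      unfolding form_diff_left form_scale_left by (simp add: a_def)
    moreover have "form N S (\<lambda>i. r i - a * q i) (unit u) = 0" if "u \<in> T" for u
      using r q that by (simp add: form_diff_left form_scale_left residual_def)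
    moreover have "r i - a * q i = unit s i" if "i \<in> N - insert t T" for i
      using r q that by (auto simp: residual_def unit_def)
    ultimately show ?case
      by (intro exI[of _ "\<lambda>i. r i - a * q i"]) (simp add: residual_def)
  qed
qed

text \<open>The columns of the inverse are the residuals of each \<open>j \<in> T\<close> on \<open>T - {j}\<close>, normalised so that they
  form the basis dual to the variables in \<open>T\<close>.\<close>

lemma inverse_on_exists:
  assumes "T \<subseteq> N"
  shows "is_inverse_on T S (inverse_on T S)"
proof -
  have "\<forall>j. \<exists>r. residual N S (T - {j}) j r"
    using residual_exists assms by blast
  then obtain R where R: "\<And>j. residual N S (T - {j}) j (R j)" by metis
  define b where "b j i = R j i / form N S (R j) (R j)" for i j
  have dual: "form N S (b j) (unit i) = (if i = j then 1 else 0)" if "i \<in> T" "j \<in> T" for i j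
  proof -
    have "form N S (b j) (unit i) = form N S (R j) (unit i) / form N S (R j) (R j)"
      using form_scale_left[of N S "1 / form N S (R j) (R j)" "R j"] by (simp add: b_def[abs_def])
    moreover have "form N S (R j) (unit j) = form N S (R j) (R j)"
      using residual_form_self[OF R] assms by blast
    moreover have "0 < form N S (R j) (R j)"
      using residual_pos[OF R] that assms by blast
    moreover have "form N S (R j) (unit i) = 0" if "i \<noteq> j"
      using R[of j] that \<open>i \<in> T\<close> by (simp add: residual_def)
    ultimately show ?thesis by auto
  qed
  have supp: "b j i = 0" if "i \<in> N - T" "j \<in> T" for i j
    using R[of j] that by (auto simp: residual_def b_def unit_def)
  have b_commute: "b j k = b k j" if "j \<in> T" "k \<in> T" for j k
  proof -
    have "finite T" using assms finite_N finite_subset by blast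
    have "form N S (b j) (b k) = b k j" if "j \<in> T" "k \<in> T" for j k
    proof -
      have "form N S (b j) (b k) = (\<Sum>i\<in>T. b k i * form N S (b j) (unit i))"
        using form_supported[OF assms] supp[OF _ that(2)] by blast
      also have "\<dots> = (\<Sum>i\<in>T. if i = j then b k i else 0)"
        using dual that by (intro sum.cong) auto
      finally show ?thesis using \<open>finite T\<close> that by simp
    qed
    with that form_commute show ?thesis by metis
  qed
  have S_commute: "S i j = S j i" if "i \<in> T" "j \<in> T" for i j
    using pd assms that unfolding positive_definite_on_def by blast
  have prod: "(\<Sum>k\<in>T. b j k * S k i) = (if i = j then 1 else 0)" if "i \<in> T" "j \<in> T" for i j
  proof -
    have "(\<Sum>k\<in>T. b j k * S k i) = (\<Sum>k\<in>N. b j k * S k i)"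
      using supp that assms finite_N by (intro sum.mono_neutral_left) auto
    then show ?thesis
      using dual[OF that] form_unit_right[OF finite_N, where i = i and c = "b j" and S = S] that assms
      by auto
  qed
  have "is_inverse_on T S b"
    unfolding is_inverse_on_def
  proof (intro ballI conjI)
    fix i j assume ij: "i \<in> T" "j \<in> T"
    have "(\<Sum>k\<in>T. S i k * b k j) = (\<Sum>k\<in>T. b j k * S k i)"
      using ij b_commute S_commute by (intro sum.cong) auto
    then show "(\<Sum>k\<in>T. S i k * b k j) = (if i = j then 1 else 0)"
      using prod[OF ij] by simp
    show "(\<Sum>k\<in>T. b i k * S k j) = (if i = j then 1 else 0)"
      using prod[OF ij(2,1)] by auto
  qed
  then show ?thesis
    unfolding inverse_on_def using someI[of "is_inverse_on T S" b] by simp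
qed

text \<open>The Schur complement that defines the partial covariance solves the normal equations, so it is the
  covariance with the unique residual.\<close>

lemma partial_cov_residual:
  assumes T: "T \<subseteq> N" and s: "s \<in> N" "s' \<in> N" and r: "residual N S T s' r"
  shows "partial_cov S T s s' = form N S r (unit s)"
proof -
  let ?I = "inverse_on T S"
  have finT: "finite T" using T finite_N finite_subset by blast
  define \<beta> where "\<beta> t = (\<Sum>t'\<in>T. ?I t t' * S t' s')" for t
  define q where "q i = unit s' i - (if i \<in> T then \<beta> i else 0)" for i
  have S_commute: "S i j = S j i" if "i \<in> N" "j \<in> N" for i j
    using pd that by (auto simp: positive_definite_on_def)
  have q_form: "form N S q (unit u) = S u s' - (\<Sum>t\<in>T. S u t * \<beta> t)" if u: "u \<in> N" for u
  proof -
    have "form N S q (unit u) = (\<Sum>j\<in>N. unit s' j * S j u) - (\<Sum>j\<in>N. if j \<in> T then S j u * \<beta> j else 0)"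
      unfolding form_unit_right[OF finite_N u] q_def sum_subtractf[symmetric]
      by (intro sum.cong) (auto simp: algebra_simps)
    moreover have "(\<Sum>j\<in>N. if j \<in> T then S j u * \<beta> j else 0) = (\<Sum>j\<in>T. S u j * \<beta> j)"
    proof -
      have "(\<Sum>j\<in>N. if j \<in> T then S j u * \<beta> j else 0) = (\<Sum>j\<in>T. S j u * \<beta> j)"
        using T finite_N by (simp add: sum.If_cases Int_absorb1)
      also have "\<dots> = (\<Sum>j\<in>T. S u j * \<beta> j)"
        using T u S_commute by (intro sum.cong) auto
      finally show ?thesis .
    qed
    ultimately show ?thesis
      using sum_unit_mult[OF finite_N s(2)] S_commute[OF u s(2)] by simp
  qed
  have "(\<Sum>t\<in>T. S u t * \<beta> t) = S u s'" if u: "u \<in> T" for u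
  proof -
    have "(\<Sum>t\<in>T. S u t * \<beta> t) = (\<Sum>t\<in>T. \<Sum>t'\<in>T. S u t * ?I t t' * S t' s')"
      by (simp add: \<beta>_def sum_distrib_left mult.assoc)
    also have "\<dots> = (\<Sum>t'\<in>T. (\<Sum>t\<in>T. S u t * ?I t t') * S t' s')"
      by (subst sum.swap) (simp add: sum_distrib_right)
    also have "\<dots> = (\<Sum>t'\<in>T. if t' = u then S t' s' else 0)"
      using inverse_on_exists[OF T] u by (intro sum.cong) (auto simp: is_inverse_on_def)
    finally show ?thesis using finT u by simp
  qed
  then have "residual N S T s' q"
    using q_form T by (auto simp: residual_def q_def)
  then have "form N S r (unit s) = form N S q (unit s)"
    using residual_unique[OF r _ T] by (intro form_cong) auto
  also have "\<dots> = partial_cov S T s s'"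
    using q_form[OF s(1)] by (simp add: partial_cov_def \<beta>_def sum_distrib_left mult.assoc)
  finally show ?thesis by simp
qed

lemma partial_cov_self:
  assumes "T \<subseteq> N" "s \<in> N" "residual N S T s r"
  shows "partial_cov S T s s = form N S r r"
  using partial_cov_residual[OF assms(1,2,2,3)] residual_form_self[OF assms(3,1)] by simp

lemma partial_cov_pos:
  assumes "T \<subseteq> N" "s \<in> N" "s \<notin> T"
  shows "0 < partial_cov S T s s"
  using assms residual_exists[OF assms(1), of s] partial_cov_self residual_pos by metis

lemma partial_cov_antimono:
  assumes "T \<subseteq> T'" "T' \<subseteq> N" "s \<in> N"
  shows "partial_cov S T' s s \<le> partial_cov S T s s"
proof -
  have T: "T \<subseteq> N" using assms by blast
  obtain r where r: "residual N S T s r"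
    using residual_exists[OF T] by blast
  obtain r' where r': "residual N S T' s r'"
    using residual_exists[OF assms(2)] by blast
  let ?d = "\<lambda>i. r i - r' i"
  have "form N S r' ?d = 0"
    using r r' assms by (intro residual_orthogonal[OF r']) (auto simp: residual_def)
  then have "form N S ?d ?d = form N S r ?d"
    by (simp add: form_diff_left)
  also have "\<dots> = form N S r r - form N S r r'"
    unfolding form_commute[of r ?d] using form_commute[of r' r] by (simp add: form_diff_left)
  also have "form N S r r' = form N S r' r'"
    using \<open>form N S r' ?d = 0\<close> form_commute[of r' ?d] by (simp add: form_diff_left)
  finally have "form N S r' r' \<le> form N S r r"
    using form_nonneg[of ?d] by simp
  then show ?thesis
    using partial_cov_self[OF T assms(3) r] partial_cov_self[OF assms(2,3) r'] by simp
qed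

lemma partial_cov_insert_uncorrelated:
  assumes "insert z T \<subseteq> N" "s \<in> N" "residual N S T s r" "form N S r (unit z) = 0"
  shows "partial_cov S (insert z T) s s = partial_cov S T s s"
proof -
  have "residual N S (insert z T) s r"
    using assms(3,4) by (auto simp: residual_def)
  then show ?thesis
    using assms partial_cov_self[of _ s r] by auto
qed

end

section \<open>The Markov property of linear models\<close>

text \<open>The coefficients of the error term of the structural equation for \<open>k\<close>.\<close>

definition error_vector :: "('v \<times> 'v) set \<Rightarrow> ('v \<Rightarrow> 'v \<Rightarrow> real) \<Rightarrow> 'v \<Rightarrow> 'v \<Rightarrow> real" where
  "error_vector r \<alpha> k i = unit k i - (if (i, k) \<in> r then \<alpha> k i else 0)"

context
  fixes N :: "'v set" and S \<alpha> :: "'v \<Rightarrow> 'v \<Rightarrow> real" and r :: "('v \<times> 'v) set"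
  assumes pdN: "positive_definite_on N S" and rN: "r \<subseteq> N \<times> N" and acyclic_r: "acyclic r"
    and uncorrelated: "\<And>k l. k \<in> N \<Longrightarrow> l \<in> N \<Longrightarrow> k \<noteq> l \<Longrightarrow>
      form N S (error_vector r \<alpha> k) (error_vector r \<alpha> l) = 0"
begin

lemma finite_nodes: "finite N"
  using pdN by (simp add: positive_definite_on_def)

text \<open>In an acyclic system every variable is a linear combination of the errors of its ancestors.\<close>

lemma unit_error_expansion:
  assumes A: "A \<subseteq> N" "r\<inverse> `` A \<subseteq> A" and k: "k \<in> A"
  shows "\<exists>t. \<forall>i. unit k i = (\<Sum>l\<in>A. t l * error_vector r \<alpha> l i)"
proof -
  have finA: "finite A" using A(1) finite_nodes finite_subset by blast
  have "finite r" using rN finite_nodes by (meson finite_SigmaI finite_subset)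
  then have "wf r" using acyclic_r finite_acyclic_wf by blast
  then show ?thesis
    using k
  proof (induction k rule: wf_induct_rule)
    case (less k)
    let ?P = "{j. (j, k) \<in> r}"
    have finP: "finite ?P"
      using rN finite_nodes by (auto intro: finite_subset)
    have "\<forall>j\<in>?P. \<exists>t. \<forall>i. unit j i = (\<Sum>l\<in>A. t l * error_vector r \<alpha> l i)"
      using less A(2) by auto
    from bchoice[OF this]
    obtain t where t: "\<And>j i. (j, k) \<in> r \<Longrightarrow> unit j i = (\<Sum>l\<in>A. t j l * error_vector r \<alpha> l i)"
      by auto
    define u where "u l = unit k l + (\<Sum>j\<in>?P. \<alpha> k j * t j l)" for l
    have "unit k i = (\<Sum>l\<in>A. u l * error_vector r \<alpha> l i)" for i
    proof -
      have "(\<Sum>l\<in>A. u l * error_vector r \<alpha> l i) = (\<Sum>l\<in>A. unit k l * error_vector r \<alpha> l i)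
          + (\<Sum>l\<in>A. \<Sum>j\<in>?P. \<alpha> k j * (t j l * error_vector r \<alpha> l i))"
        by (simp add: u_def distrib_right sum.distrib sum_distrib_right mult.assoc)
      also have "(\<Sum>l\<in>A. \<Sum>j\<in>?P. \<alpha> k j * (t j l * error_vector r \<alpha> l i))
          = (\<Sum>j\<in>?P. \<alpha> k j * unit j i)"
        by (subst sum.swap) (auto simp: t sum_distrib_left intro!: sum.cong)
      also have "\<dots> = (if (i, k) \<in> r then \<alpha> k i else 0)"
      proof -
        have "(\<Sum>j\<in>?P. \<alpha> k j * unit j i) = (\<Sum>j\<in>?P. if j = i then \<alpha> k j else 0)"
          by (intro sum.cong) (auto simp: unit_def)
        then show ?thesis using finP by simp
      qed
      also have "(\<Sum>l\<in>A. unit k l * error_vector r \<alpha> l i) = error_vector r \<alpha> k i"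
        using sum_unit_mult[OF finA less.prems] .
      finally show ?thesis by (simp add: error_vector_def)
    qed
    then show ?case by blast
  qed
qed

lemma error_expansion:
  assumes A: "A \<subseteq> N" "r\<inverse> `` A \<subseteq> A"
    and c: "\<And>i. i \<in> N - A \<Longrightarrow> c i = 0"
  shows "\<exists>t. \<forall>i\<in>N. c i = (\<Sum>l\<in>A. t l * error_vector r \<alpha> l i)"
proof -
  have finA: "finite A" using A(1) finite_nodes finite_subset by blast
  have "\<forall>k\<in>A. \<exists>t. \<forall>i. unit k i = (\<Sum>l\<in>A. t l * error_vector r \<alpha> l i)"
    using unit_error_expansion[OF A] by blast
  from bchoice[OF this]
  obtain t where t: "\<And>k i. k \<in> A \<Longrightarrow> unit k i = (\<Sum>l\<in>A. t k l * error_vector r \<alpha> l i)"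
    by auto
  have "c i = (\<Sum>l\<in>A. (\<Sum>k\<in>A. c k * t k l) * error_vector r \<alpha> l i)" if "i \<in> N" for i
  proof -
    have "c i = (\<Sum>k\<in>A. if k = i then c k else 0)"
      using finA c[of i] that by simp
    also have "\<dots> = (\<Sum>k\<in>A. c k * unit k i)"
      by (intro sum.cong) (auto simp: unit_def)
    also have "\<dots> = (\<Sum>k\<in>A. \<Sum>l\<in>A. c k * t k l * error_vector r \<alpha> l i)"
      by (intro sum.cong) (auto simp: t sum_distrib_left mult.assoc)
    also have "\<dots> = (\<Sum>l\<in>A. (\<Sum>k\<in>A. c k * t k l) * error_vector r \<alpha> l i)"
      by (subst sum.swap) (simp add: sum_distrib_right)
    finally show ?thesis .
  qed
  then show ?thesis by (intro exI[of _ "\<lambda>l. \<Sum>k\<in>A. c k * t k l"]) blast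
qed

text \<open>Let \<open>A1\<close> be the nodes whose family (the node and its parents) lies within \<open>C \<union> W\<close>, and \<open>A2\<close> the rest
  of \<open>A\<close>, whose families avoid \<open>C\<close>. Write the residual of \<open>a\<close> as \<open>R1 + R2\<close> according to these two
  groups of errors. Then \<open>R2 = R - R1\<close> is supported both within \<open>C \<union> W\<close> and off \<open>C\<close>, hence on \<open>W\<close>; so
  \<open>R2\<close> is orthogonal to \<open>R\<close>, and it is orthogonal to \<open>R1\<close>, whence \<open>R2 = 0\<close>. Symmetrically the
  residual of \<open>b\<close> has no component from \<open>A1\<close>, and the two residuals are orthogonal.\<close>

lemma residual_uncorrelated_if_families_split:
  assumes A: "A \<subseteq> N" "r\<inverse> `` A \<subseteq> A" and W: "W \<subseteq> A" "C \<inter> W = {}"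
    and fam: "\<And>k. k \<in> A \<Longrightarrow>
      insert k {j. (j, k) \<in> r} \<inter> C = {} \<or> insert k {j. (j, k) \<in> r} \<subseteq> C \<union> W"
    and a: "a \<in> A" "a \<in> C" and b: "b \<in> A" "b \<notin> C" "b \<notin> W" and R: "residual N S W a R"
  shows "form N S R (unit b) = 0"
proof -
  let ?e = "error_vector r \<alpha>"
  let ?fam = "\<lambda>k. insert k {j. (j, k) \<in> r}"
  define A1 where "A1 = {k \<in> A. ?fam k \<subseteq> C \<union> W}"
  define A2 where "A2 = {k \<in> A. \<not> ?fam k \<subseteq> C \<union> W}"
  have finA: "finite A" using A(1) finite_nodes finite_subset by blast
  have WN: "W \<subseteq> N" using W A by blast
  have e_supp: "?e k i = 0" if "i \<notin> ?fam k" for k i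
    using that by (simp add: error_vector_def unit_def)
  have supp1: "(\<Sum>k\<in>A1. t k * ?e k i) = 0" if "i \<notin> C \<union> W" for t i
  proof (intro sum.neutral ballI)
    fix k assume "k \<in> A1"
    then have "i \<notin> ?fam k" using that by (auto simp: A1_def)
    with e_supp show "t k * ?e k i = 0" by simp
  qed
  have supp2: "(\<Sum>k\<in>A2. t k * ?e k i) = 0" if "i \<in> C" for t i
  proof (intro sum.neutral ballI)
    fix k assume "k \<in> A2"
    then have "?fam k \<inter> C = {}" using fam[of k] by (auto simp: A2_def)
    with that have "i \<notin> ?fam k" by blast
    with e_supp show "t k * ?e k i = 0" by simp
  qed
  have orth: "form N S (\<lambda>i. \<Sum>k\<in>A1. t k * ?e k i) (\<lambda>i. \<Sum>k\<in>A2. u k * ?e k i) = 0" for t u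
  proof -
    have "form N S (?e k) (\<lambda>i. \<Sum>l\<in>A2. u l * ?e l i) = 0" if "k \<in> A1" for k
    proof -
      have "form N S (?e l) (?e k) = 0" if "l \<in> A2" for l
        using that \<open>k \<in> A1\<close> A(1) by (intro uncorrelated) (auto simp: A1_def A2_def)
      then show ?thesis
        unfolding form_commute[OF pdN, of "?e k"] form_sum_left by simp
    qed
    then show ?thesis unfolding form_sum_left by simp
  qed
  have split: "\<exists>t. \<forall>i\<in>N. c i = (\<Sum>k\<in>A1. t k * ?e k i) + (\<Sum>k\<in>A2. t k * ?e k i)"
    if c: "\<And>i. i \<in> N - A \<Longrightarrow> c i = 0" for c
  proof -
    have "(\<Sum>k\<in>A. h k) = (\<Sum>k\<in>A1. h k) + (\<Sum>k\<in>A2. h k)" for h :: "'v \<Rightarrow> real"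
    proof -
      have "A = A1 \<union> A2" "A1 \<inter> A2 = {}" by (auto simp: A1_def A2_def)
      with finA show ?thesis by (simp add: sum.union_disjoint)
    qed
    then show ?thesis using error_expansion[OF A, of c] c by simp
  qed

  have "R i = 0" if "i \<in> N - A" for i
  proof -
    have "i \<in> N - W" "i \<noteq> a" using that a(1) W(1) by auto
    with R show ?thesis by (simp add: residual_def unit_def)
  qed
  then obtain t where t: "\<And>i. i \<in> N \<Longrightarrow> R i = (\<Sum>k\<in>A1. t k * ?e k i) + (\<Sum>k\<in>A2. t k * ?e k i)"
    using split[of R] by blast
  obtain Q where Q: "residual N S W b Q"
    using residual_exists[OF pdN WN] by blast
  have "Q i = 0" if "i \<in> N - A" for i
  proof -
    have "i \<in> N - W" "i \<noteq> b" using that b(1) W(1) by auto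
    with Q show ?thesis by (simp add: residual_def unit_def)
  qed
  then obtain u where u: "\<And>i. i \<in> N \<Longrightarrow> Q i = (\<Sum>k\<in>A1. u k * ?e k i) + (\<Sum>k\<in>A2. u k * ?e k i)"
    using split[of Q] by blast
  define R1 R2 Q1 Q2 where "R1 i = (\<Sum>k\<in>A1. t k * ?e k i)" and "R2 i = (\<Sum>k\<in>A2. t k * ?e k i)"
    and "Q1 i = (\<Sum>k\<in>A1. u k * ?e k i)" and "Q2 i = (\<Sum>k\<in>A2. u k * ?e k i)" for i
  have o: "form N S R1 R2 = 0" "form N S Q1 Q2 = 0" "form N S R1 Q2 = 0"
    using orth by (simp_all add: R1_def[abs_def] R2_def[abs_def] Q1_def[abs_def] Q2_def[abs_def])
  have R_eq: "R i = R1 i + R2 i" if "i \<in> N" for i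
    using t[OF that] by (simp add: R1_def R2_def)
  have R_sum: "form N S R d = form N S R1 d + form N S R2 d" for d
    unfolding form_add_left[symmetric] using R_eq by (rule form_cong) simp_all
  have Q_eq: "Q i = Q1 i + Q2 i" if "i \<in> N" for i
    using u[OF that] by (simp add: Q1_def Q2_def)
  have Q_sum: "form N S Q d = form N S Q1 d + form N S Q2 d" for d
    unfolding form_add_left[symmetric] using Q_eq by (rule form_cong) simp_all

  have "R2 i = 0" if "i \<in> N - W" for i
  proof (cases "i \<in> C")
    case False
    then have "R i = 0" "R1 i = 0"
      using that R a(2) supp1[of i t] by (auto simp: residual_def unit_def R1_def)
    with R_eq[of i] that show ?thesis by simp
  qed (simp add: R2_def supp2)
  then have "form N S R R2 = 0"
    using residual_orthogonal[OF pdN R WN] by blast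
  then have "form N S R2 R2 = 0"
    using R_sum[of R2] o by simp
  then have R2: "R2 i = 0" if "i \<in> N" for i
    using form_eq_0D[OF pdN] that by blast

  have "Q1 i = 0" if "i \<in> N - W" for i
  proof (cases "i \<in> C")
    case True
    then have "Q i = 0" "Q2 i = 0"
      using that Q b(2) supp2[of i u] by (auto simp: residual_def unit_def Q2_def)
    with Q_eq[of i] that show ?thesis by simp
  next
    case False
    with that supp1[of i u] show ?thesis by (simp add: Q1_def)
  qed
  then have "form N S Q Q1 = 0"
    using residual_orthogonal[OF pdN Q WN] by blast
  then have "form N S Q1 Q1 = 0"
    using Q_sum[of Q1] o form_commute[OF pdN] by simp
  then have Q1: "Q1 i = 0" if "i \<in> N" for i
    using form_eq_0D[OF pdN] that by blast

  have "form N S R (unit b) = form N S R Q"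
    using Q by (intro residual_form[OF pdN R WN]) (auto simp: residual_def)
  also have "\<dots> = form N S R1 Q2"
    using R2 Q1 R_eq Q_eq by (intro form_cong) auto
  finally show ?thesis using o by simp
qed

text \<open>Every ancestor \<open>k\<close> of \<open>W\<close> can be passed as a collider. An ancestor of \<open>b\<close> only would give an open walk
  from \<open>a\<close> to \<open>b\<close>. From an ancestor of \<open>a\<close> only, the directed path back to \<open>a\<close>, reversed, is a walk
  that arrives at \<open>j\<close> through \<open>k\<close> as a non-collider. The last assumption rules out that \<open>k\<close> lies in \<open>W\<close>
  and the walk leaves it again as a non-collider.\<close>

lemma open_walk_to_parent:
  assumes nob: "walk_sep r {a} {b} W" and k: "k \<in> anc r (insert a (insert b W))" and jk: "(j, k) \<in> r"
    and p: "open_walk r W p" "hd p = a" "last p = k"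
    and into: "k \<notin> W \<or> (\<exists>i q. p = q @ [i, k] \<and> (i, k) \<in> r)"
  shows "\<exists>p. open_walk r W p \<and> hd p = a \<and> last p = j"
proof (cases "k \<in> anc r W")
  case True
  obtain q where q: "p = q @ [k]"
    using p by (cases p rule: rev_cases) auto
  have "passable r W (last q) k j" if "q \<noteq> []"
    using into q True jk by (auto simp: passable_def)
  then have "open_walk r W (p @ [j])"
    using p q jk open_walk_snoc2[of r W q k j] by simp
  then show ?thesis
    using p(2) q by (intro exI[of _ "p @ [j]"]) (auto simp: hd_append split: if_splits)
next
  case False
  then consider "(k, a) \<in> r\<^sup>*" | "(k, b) \<in> r\<^sup>*"
    using k by (auto simp: anc_def)
  then show ?thesis
  proof cases
    case 1
    then obtain q where q: "open_walk r W ([j, k] @ q)" "last ([j, k] @ q) = a"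
      using open_walk_directed[OF acyclic_r, of W "[j, k]" a] False jk by auto
    then have "open_walk r W (rev ([j, k] @ q))" "hd (rev ([j, k] @ q)) = a"
      using open_walk_rev[of r W "[j, k] @ q"] hd_rev[of "[j, k] @ q"] by simp_all
    then show ?thesis by (intro exI[of _ "rev ([j, k] @ q)"]) simp
  next
    case 2
    then obtain q where "open_walk r W (p @ q)" "last (p @ q) = b"
      using open_walk_directed[OF acyclic_r p(1)] p False by auto
    moreover have "hd (p @ q) = a" using p by (cases p) auto
    ultimately show ?thesis using nob by (auto simp: walk_sep_def)
  qed
qed

text \<open>Restrict the system to the ancestors of \<open>a\<close>, \<open>b\<close> and \<open>W\<close>, and let \<open>C\<close> consist of the nodes outside
  \<open>W\<close> that are reachable from \<open>a\<close> by an open walk. Once \<open>C\<close> meets a family, it contains all of that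
  family except for \<open>W\<close>, so the families split as required.\<close>

theorem walk_sep_imp_uncorrelated:
  assumes "W \<subseteq> N" "a \<in> N" "b \<in> N" "a \<notin> W" "b \<notin> W" and sep: "walk_sep r {a} {b} W"
    and R: "residual N S W a R"
  shows "form N S R (unit b) = 0"
proof -
  let ?A = "anc r (insert a (insert b W))"
  define reach where "reach v \<longleftrightarrow> (\<exists>p. open_walk r W p \<and> hd p = a \<and> last p = v)" for v
  let ?C = "{v. reach v} - W"
  have child: "reach k \<and> (\<forall>j. (j, k) \<in> r \<longrightarrow> reach j)"
    if k: "k \<in> ?A" and ik: "(i, k) \<in> r" "reach i" "i \<notin> W" for i k
  proof -
    obtain p where p: "open_walk r W p" "hd p = a" "last p = i"
      using ik by (auto simp: reach_def)
    then obtain q where q: "p = q @ [i]"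
      by (cases p rule: rev_cases) auto
    have "open_walk r W (q @ [i, k])"
      using p q ik passable_out[OF acyclic_r, of i _ k W] open_walk_snoc2[of r W q i k] by simp
    moreover have "hd (q @ [i, k]) = a" using p q by (cases q) auto
    ultimately show ?thesis
      using open_walk_to_parent[OF sep k, of _ "q @ [i, k]"] ik by (fastforce simp: reach_def)
  qed
  have "reach j" if k: "k \<in> ?A" and ij: "i \<in> insert k {j. (j, k) \<in> r}" "j \<in> insert k {j. (j, k) \<in> r}"
    and i: "reach i" "i \<notin> W" for i j k
  proof (cases "i = k")
    case True
    with i obtain p where "open_walk r W p" "hd p = a" "last p = k"
      by (auto simp: reach_def)
    with ij i True open_walk_to_parent[OF sep k, of j p] show ?thesis
      by (auto simp: reach_def)
  qed (use child[of k i] k ij i in auto)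
  then have fam: "insert k {j. (j, k) \<in> r} \<inter> ?C = {} \<or> insert k {j. (j, k) \<in> r} \<subseteq> ?C \<union> W"
    if "k \<in> ?A" for k
    using that by blast
  have "?A \<subseteq> N"
  proof
    fix v assume "v \<in> ?A"
    then obtain w where w: "(v, w) \<in> r\<^sup>*" "w \<in> insert a (insert b W)"
      by (auto simp: anc_def)
    show "v \<in> N"
      by (rule converse_rtranclE[OF w(1)]) (use assms(1-3) rN w(2) in auto)
  qed
  moreover have "r\<inverse> `` ?A \<subseteq> ?A"
    using anc_step by fast
  moreover have "reach a"
    unfolding reach_def by (intro exI[of _ "[a]"]) simp
  moreover have "\<not> reach b"
    using sep by (auto simp: reach_def walk_sep_def)
  moreover have "insert a (insert b W) \<subseteq> ?A"
    by (rule anc_superset)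
  ultimately show ?thesis
    using residual_uncorrelated_if_families_split[of ?A W ?C a b R] fam R assms(4,5) by blast
qed

end

section \<open>Covariances of a causal linear model\<close>

definition square_integrable :: "'w measure \<Rightarrow> ('w \<Rightarrow> real) \<Rightarrow> bool" where
  "square_integrable M f \<longleftrightarrow> f \<in> borel_measurable M \<and> integrable M (\<lambda>\<omega>. (f \<omega>)\<^sup>2)"

lemma square_integrable_mult:
  assumes "square_integrable M f" "square_integrable M g"
  shows "integrable M (\<lambda>\<omega>. f \<omega> * g \<omega>)"
proof (rule Bochner_Integration.integrable_bound)
  show "integrable M (\<lambda>\<omega>. (f \<omega>)\<^sup>2 + (g \<omega>)\<^sup>2)"
    using assms by (auto simp: square_integrable_def)
  show "(\<lambda>\<omega>. f \<omega> * g \<omega>) \<in> borel_measurable M"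
    using assms by (auto simp: square_integrable_def)
  have "\<bar>x * y\<bar> \<le> x\<^sup>2 + y\<^sup>2" for x y :: real
  proof -
    have "0 \<le> (\<bar>x\<bar> - \<bar>y\<bar>)\<^sup>2" by simp
    then have "2 * (\<bar>x\<bar> * \<bar>y\<bar>) \<le> x\<^sup>2 + y\<^sup>2"
      by (simp add: power2_diff)
    moreover have "0 \<le> \<bar>x\<bar> * \<bar>y\<bar>" by simp
    ultimately show ?thesis unfolding abs_mult by linarith
  qed
  then show "AE \<omega> in M. norm (f \<omega> * g \<omega>) \<le> norm ((f \<omega>)\<^sup>2 + (g \<omega>)\<^sup>2)"
    by (simp add: order_trans[OF _ abs_ge_self])
qed

lemma square_integrable_scale: "square_integrable M f \<Longrightarrow> square_integrable M (\<lambda>\<omega>. a * f \<omega>)"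
  by (auto simp: square_integrable_def power_mult_distrib)

lemma square_integrable_add:
  assumes "square_integrable M f" "square_integrable M g"
  shows "square_integrable M (\<lambda>\<omega>. f \<omega> + g \<omega>)"
  using assms square_integrable_mult[OF assms]
  by (auto simp: square_integrable_def power2_sum mult.assoc)

lemma square_integrable_sum:
  "(\<And>i. i \<in> I \<Longrightarrow> square_integrable M (f i)) \<Longrightarrow> square_integrable M (\<lambda>\<omega>. \<Sum>i\<in>I. f i \<omega>)"
proof (induction I rule: infinite_finite_induct)
  case (insert i I)
  then show ?case using square_integrable_add[of M "f i"] by simp
qed (simp_all add: square_integrable_def)

lemma square_integrable_cong_AE:
  assumes "square_integrable M g" "f \<in> borel_measurable M" "AE \<omega> in M. f \<omega> = g \<omega>"
  shows "square_integrable M f"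
proof -
  have "integrable M (\<lambda>\<omega>. (f \<omega>)\<^sup>2) \<longleftrightarrow> integrable M (\<lambda>\<omega>. (g \<omega>)\<^sup>2)"
    using assms by (intro integrable_cong_AE) (auto simp: square_integrable_def)
  with assms show ?thesis by (simp add: square_integrable_def)
qed

lemma (in prob_space) square_integrable_integrable:
  "square_integrable M f \<Longrightarrow> integrable M f"
  using square_integrable_imp_integrable by (auto simp: square_integrable_def)

lemma form_gram:
  assumes V: "\<And>i. i \<in> N \<Longrightarrow> square_integrable M (V i)"
    and S: "\<And>i j. i \<in> N \<Longrightarrow> j \<in> N \<Longrightarrow> S i j = (\<integral>\<omega>. V i \<omega> * V j \<omega> \<partial>M)"
  shows "form N S c d = (\<integral>\<omega>. (\<Sum>i\<in>N. c i * V i \<omega>) * (\<Sum>i\<in>N. d i * V i \<omega>) \<partial>M)"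
proof -
  have int: "integrable M (\<lambda>\<omega>. c i * d j * (V i \<omega> * V j \<omega>))" if "i \<in> N" "j \<in> N" for i j
    using square_integrable_mult V that by auto
  have "form N S c d = (\<Sum>i\<in>N. \<Sum>j\<in>N. \<integral>\<omega>. c i * d j * (V i \<omega> * V j \<omega>) \<partial>M)"
    unfolding form_def using S by (intro sum.cong refl) simp
  also have "\<dots> = (\<Sum>i\<in>N. \<integral>\<omega>. (\<Sum>j\<in>N. c i * d j * (V i \<omega> * V j \<omega>)) \<partial>M)"
    using int by (intro sum.cong refl Bochner_Integration.integral_sum[symmetric])
  also have "\<dots> = (\<integral>\<omega>. (\<Sum>i\<in>N. \<Sum>j\<in>N. c i * d j * (V i \<omega> * V j \<omega>)) \<partial>M)"
    using int by (intro Bochner_Integration.integral_sum[symmetric] Bochner_Integration.integrable_sum)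
  finally show ?thesis
    by (simp add: sum_product ac_simps)
qed

text \<open>If a linear combination has zero second moment, it vanishes almost surely and is orthogonal to all
  variables; applying the inverse matrix shows that its coefficients are zero.\<close>

lemma nonsingular_gram_positive_definite:
  assumes fin: "finite N" and V: "\<And>i. i \<in> N \<Longrightarrow> square_integrable M (V i)"
    and S: "\<And>i j. i \<in> N \<Longrightarrow> j \<in> N \<Longrightarrow> S i j = (\<integral>\<omega>. V i \<omega> * V j \<omega> \<partial>M)"
    and ns: "nonsingular_on N S"
  shows "positive_definite_on N S"
proof -
  define L where "L c \<omega> = (\<Sum>i\<in>N. c i * V i \<omega>)" for c \<omega>
  have form_L: "form N S c d = (\<integral>\<omega>. L c \<omega> * L d \<omega> \<partial>M)" for c d
    unfolding L_def by (rule form_gram) (use V S in auto)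
  have L_sq: "square_integrable M (L c)" for c
    unfolding L_def[abs_def] using V by (intro square_integrable_sum square_integrable_scale)
  obtain B where B: "is_inverse_on N S B" using ns by (auto simp: nonsingular_on_def)
  have "c l = 0" if c0: "form N S c c = 0" and l: "l \<in> N" for c l
  proof -
    have "(\<integral>\<omega>. L c \<omega> * L c \<omega> \<partial>M) = 0" using c0 form_L by simp
    then have "AE \<omega> in M. L c \<omega> * L c \<omega> = 0"
      using square_integrable_mult[OF L_sq L_sq, of c c]
      by (subst (asm) integral_nonneg_eq_0_iff_AE) auto
    then have orth: "form N S c (unit k) = 0" for k
      unfolding form_L by (intro integral_eq_zero_AE) auto
    have zero: "(\<Sum>i\<in>N. c i * S i k) = 0" if "k \<in> N" for k
      using orth[of k] form_unit_right[OF fin that, where c = c and S = S] by simp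
    have "c l = (\<Sum>i\<in>N. c i * (\<Sum>k\<in>N. S i k * B k l))"
    proof -
      have "(\<Sum>i\<in>N. c i * (\<Sum>k\<in>N. S i k * B k l)) = (\<Sum>i\<in>N. if i = l then c i else 0)"
        using B l by (intro sum.cong) (auto simp: is_inverse_on_def)
      then show ?thesis using fin l by simp
    qed
    also have "\<dots> = (\<Sum>k\<in>N. (\<Sum>i\<in>N. c i * S i k) * B k l)"
      by (simp add: sum_distrib_left sum_distrib_right mult.assoc) (rule sum.swap)
    finally show ?thesis using zero by simp
  qed
  moreover have "0 \<le> form N S c c" for c
    unfolding form_L by (intro integral_nonneg_AE) auto
  moreover have "S i j = S j i" if "i \<in> N" "j \<in> N" for i j
    using S that by (simp add: mult.commute)
  ultimately show ?thesis
    using fin unfolding positive_definite_on_def by blast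
qed

lemma (in prob_space) linear_equations_moments:
  assumes r: "finite r" "acyclic r" "r \<subseteq> N \<times> N"
    and V: "\<And>i. i \<in> N \<Longrightarrow> V i \<in> borel_measurable M"
    and \<epsilon>: "\<And>i. i \<in> N \<Longrightarrow> square_integrable M (\<epsilon> i)" "\<And>i. i \<in> N \<Longrightarrow> integral\<^sup>L M (\<epsilon> i) = 0"
    and eq: "\<And>i. i \<in> N \<Longrightarrow> AE \<omega> in M. V i \<omega> = (\<Sum>j | (j, i) \<in> r. \<alpha> i j * V j \<omega>) + \<epsilon> i \<omega>"
    and i: "i \<in> N"
  shows "square_integrable M (V i) \<and> integral\<^sup>L M (V i) = 0"
proof -
  have "wf r" using r finite_acyclic_wf by blast
  then show ?thesis
    using i
  proof (induction i rule: wf_induct_rule)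
    case (less i)
    let ?P = "{j. (j, i) \<in> r}"
    have IH: "square_integrable M (V j)" "integral\<^sup>L M (V j) = 0" if "j \<in> ?P" for j
      using less.IH[of j] that r(3) by auto
    define g where "g \<omega> = (\<Sum>j\<in>?P. \<alpha> i j * V j \<omega>) + \<epsilon> i \<omega>" for \<omega>
    have sq: "square_integrable M g"
      unfolding g_def[abs_def] using IH \<epsilon>(1)[OF less.prems]
      by (intro square_integrable_add square_integrable_sum square_integrable_scale)
    have AE_eq: "AE \<omega> in M. V i \<omega> = g \<omega>"
      using eq[OF less.prems] by (simp add: g_def)
    have int: "integrable M (\<lambda>\<omega>. \<alpha> i j * V j \<omega>)" if "j \<in> ?P" for j
      using square_integrable_integrable IH(1)[OF that] by simp
    have "integral\<^sup>L M (V i) = integral\<^sup>L M g"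
      using AE_eq sq V[OF less.prems] by (intro integral_cong_AE) (auto simp: square_integrable_def)
    also have "\<dots> = (\<integral>\<omega>. (\<Sum>j\<in>?P. \<alpha> i j * V j \<omega>) \<partial>M) + integral\<^sup>L M (\<epsilon> i)"
      unfolding g_def using int square_integrable_integrable[OF \<epsilon>(1)[OF less.prems]]
      by (intro Bochner_Integration.integral_add Bochner_Integration.integrable_sum)
    also have "(\<integral>\<omega>. (\<Sum>j\<in>?P. \<alpha> i j * V j \<omega>) \<partial>M) = (\<Sum>j\<in>?P. \<integral>\<omega>. \<alpha> i j * V j \<omega> \<partial>M)"
      using int by (intro Bochner_Integration.integral_sum)
    also have "\<dots> = 0" using IH by (intro sum.neutral) auto
    finally have "integral\<^sup>L M (V i) = 0" using \<epsilon>(2)[OF less.prems] by simp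
    moreover have "square_integrable M (V i)"
      using square_integrable_cong_AE[OF sq V[OF less.prems] AE_eq] .
    ultimately show ?case by blast
  qed
qed

lemma causal_linear_model_covariance:
  assumes D: "dag D" and model: "causal_linear_model_dag M \<mu> V f fdo D"
  shows "positive_definite_on (nodes D) (cov_matrix M V)"
    and "\<exists>\<alpha>. \<forall>k\<in>nodes D. \<forall>l\<in>nodes D. k \<noteq> l \<longrightarrow>
      form (nodes D) (cov_matrix M V) (error_vector (dir D) \<alpha> k) (error_vector (dir D) \<alpha> l) = 0"
proof -
  let ?N = "nodes D" and ?r = "dir D" and ?S = "cov_matrix M V"
  have fin: "finite ?N" and r: "?r \<subseteq> ?N \<times> ?N" "acyclic ?r"
    using D by (auto simp: dag_def pdag_def simple_graph_def)
  then have finr: "finite ?r" by (meson finite_SigmaI finite_subset)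
  interpret prob_space M using model by (simp add: causal_linear_model_dag_def)
  obtain \<alpha> \<epsilon> where indep: "indep_vars (\<lambda>_. borel) \<epsilon> ?N"
    and \<epsilon>: "\<And>i. i \<in> ?N \<Longrightarrow> integrable M (\<lambda>\<omega>. (\<epsilon> i \<omega>)\<^sup>2)" "\<And>i. i \<in> ?N \<Longrightarrow> integral\<^sup>L M (\<epsilon> i) = 0"
    and eq: "\<And>i. i \<in> ?N \<Longrightarrow> AE \<omega> in M. V i \<omega> = (\<Sum>j\<in>pa D i. \<alpha> i j * V j \<omega>) + \<epsilon> i \<omega>"
    using model unfolding causal_linear_model_dag_def by blast
  have \<epsilon>_sq: "square_integrable M (\<epsilon> i)" if "i \<in> ?N" for i
    using indep \<epsilon>(1)[OF that] that by (auto simp: indep_vars_def square_integrable_def)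
  have V_meas: "V i \<in> borel_measurable M" if i: "i \<in> ?N" for i
  proof -
    have "(\<lambda>\<omega>. \<lambda>i\<in>?N. V i \<omega>) \<in> measurable M (PiM ?N \<mu>)"
      using model by (simp add: causal_linear_model_dag_def distributed_def)
    from measurable_compose[OF this measurable_component_singleton[OF i]]
    have "V i \<in> measurable M (\<mu> i)" using i by simp
    moreover have "sets (\<mu> i) = sets borel"
      using model i by (simp add: causal_linear_model_dag_def)
    ultimately show ?thesis using measurable_cong_sets by blast
  qed
  have moments: "square_integrable M (V i) \<and> integral\<^sup>L M (V i) = 0" if "i \<in> ?N" for i
    by (rule linear_equations_moments[where r = ?r and N = ?N and \<epsilon> = \<epsilon> and \<alpha> = \<alpha>])
      (use finr r V_meas \<epsilon>_sq \<epsilon>(2) eq that in \<open>auto simp: pa_def\<close>)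
  then have V: "square_integrable M (V i)" if "i \<in> ?N" for i using that by blast
  have S: "?S i j = (\<integral>\<omega>. V i \<omega> * V j \<omega> \<partial>M)" if "i \<in> ?N" "j \<in> ?N" for i j
    using moments that by (simp add: cov_matrix_def covariance_def)
  show "positive_definite_on ?N ?S"
    by (rule nonsingular_gram_positive_definite[where M = M and V = V])
      (use fin V S model in \<open>auto simp: causal_linear_model_dag_def\<close>)

  have error: "AE \<omega> in M. (\<Sum>i\<in>?N. error_vector ?r \<alpha> k i * V i \<omega>) = \<epsilon> k \<omega>" if k: "k \<in> ?N" for k
  proof -
    have "(\<Sum>i\<in>?N. error_vector ?r \<alpha> k i * V i \<omega>) = V k \<omega> - (\<Sum>j\<in>pa D k. \<alpha> k j * V j \<omega>)" for \<omega>
    proof -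
      have "(\<Sum>i\<in>?N. (if (i, k) \<in> ?r then \<alpha> k i else 0) * V i \<omega>)
          = (\<Sum>i\<in>?N. if i \<in> pa D k then \<alpha> k i * V i \<omega> else 0)"
        by (intro sum.cong) (auto simp: pa_def)
      also have "\<dots> = (\<Sum>i\<in>?N \<inter> pa D k. \<alpha> k i * V i \<omega>)"
        using fin by (simp add: sum.inter_restrict)
      also have "?N \<inter> pa D k = pa D k" using r by (auto simp: pa_def)
      finally show ?thesis
        using sum_unit_mult[OF fin k] by (simp add: error_vector_def left_diff_distrib sum_subtractf)
    qed
    with eq[OF k] show ?thesis by auto
  qed
  have "form ?N ?S (error_vector ?r \<alpha> k) (error_vector ?r \<alpha> l) = 0"
    if kl: "k \<in> ?N" "l \<in> ?N" "k \<noteq> l" for k l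
  proof -
    have "form ?N ?S (error_vector ?r \<alpha> k) (error_vector ?r \<alpha> l)
        = (\<integral>\<omega>. (\<Sum>i\<in>?N. error_vector ?r \<alpha> k i * V i \<omega>) * (\<Sum>i\<in>?N. error_vector ?r \<alpha> l i * V i \<omega>) \<partial>M)"
      by (rule form_gram) (use V S in auto)
    also have "\<dots> = (\<integral>\<omega>. \<epsilon> k \<omega> * \<epsilon> l \<omega> \<partial>M)"
    proof (rule integral_cong_AE)
      show "AE \<omega> in M. (\<Sum>i\<in>?N. error_vector ?r \<alpha> k i * V i \<omega>)
          * (\<Sum>i\<in>?N. error_vector ?r \<alpha> l i * V i \<omega>) = \<epsilon> k \<omega> * \<epsilon> l \<omega>"
        using error[OF kl(1)] error[OF kl(2)] by eventually_elim simp
    qed (use V_meas \<epsilon>_sq kl in \<open>auto simp: square_integrable_def intro!: borel_measurable_times\<close>)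
    also have "\<dots> = (\<integral>\<omega>. (\<Prod>i\<in>{k, l}. \<epsilon> i \<omega>) \<partial>M)"
      using kl(3) by simp
    also have "\<dots> = (\<Prod>i\<in>{k, l}. \<integral>\<omega>. \<epsilon> i \<omega> \<partial>M)"
      using indep_vars_subset[OF indep, of "{k, l}"] kl \<epsilon>_sq square_integrable_integrable
      by (intro indep_vars_lebesgue_integral) auto
    also have "\<dots> = 0"
      using \<epsilon>(2) kl by simp
    finally show ?thesis .
  qed
  then show "\<exists>\<alpha>. \<forall>k\<in>?N. \<forall>l\<in>?N. k \<noteq> l \<longrightarrow>
      form ?N ?S (error_vector ?r \<alpha> k) (error_vector ?r \<alpha> l) = 0"
    by blast
qed

section \<open>Removing one node\<close>

text \<open>Dropping \<open>z\<close> can only open a path on which \<open>z\<close> is a non-collider. The part of a proper path after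
  its first node avoids \<open>X\<close>, so the piece from \<open>z\<close> to \<open>Y\<close> is open even given \<open>X\<close>.\<close>

lemma valid_adjustment_set_remove:
  assumes G: "maximal_pdag G" "D \<in> represented_dags G" "Y \<subseteq> nodes G"
    and valid: "valid_adjustment_set G X Y S" and sep: "dsep G Y {z} (X \<union> (S - {z}))"
  shows "valid_adjustment_set G X Y (S - {z})"
proof -
  have "blocked G (S - {z}) p"
    if p: "proper_path G X Y p" "non_causal G p" "definite_status G p" for p
  proof (rule ccontr)
    assume open_p: "\<not> blocked G (S - {z}) p"
    have "blocked G S p"
      using valid p by (auto simp: valid_adjustment_set_def)
    with open_p obtain i where i: "0 < i" "Suc i < length p" "p ! i = z"
      unfolding blocked_def non_collider_at_def by blast
    have path: "is_path G p" and ends: "last p \<in> Y" and proper: "set (tl p) \<inter> X = {}"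
      using p(1) by (auto simp: proper_path_def path_from_to_def)
    let ?q = "z # drop (Suc i) p"
    have split: "p = take i p @ ?q"
      using i id_take_nth_drop[of i p] by simp
    have "open_walk (dir D) (S - {z}) p"
      by (rule open_path_is_open_walk[OF G(1,2) path p(3) open_p])
    then have "open_walk (dir D) (S - {z}) ?q"
      using split open_walk_suffix by metis
    moreover have "set (tl ?q) \<inter> X = {}"
    proof -
      have "drop (Suc i) p = drop i (tl p)" by (simp add: drop_Suc)
      then show ?thesis using proper set_drop_subset[of i "tl p"] by auto
    qed
    then have "\<forall>v\<in>set (butlast (tl ?q)). v \<in> X \<union> (S - {z}) \<longrightarrow> v \<in> S - {z}"
      by (auto dest: in_set_butlastD)
    ultimately have "open_walk (dir D) (X \<union> (S - {z})) ?q"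
      using open_walk_weaken by blast
    then have "open_walk (dir D) (X \<union> (S - {z})) (rev ?q)"
      by (simp only: open_walk_rev)
    moreover have "last ?q = last p"
      using split by (metis last_appendR list.discI)
    then have "hd (rev ?q) \<in> Y"
      using ends by (simp only: hd_rev)
    moreover have "last (rev ?q) \<in> {z}"
      by simp
    moreover have "walk_sep (dir D) Y {z} (X \<union> (S - {z}))"
      using sep dsep_iff_walk_sep[OF G] by blast
    ultimately show False
      unfolding walk_sep_def by blast
  qed
  with valid show ?thesis by (auto simp: valid_adjustment_set_def)
qed

text \<open>The numerator is unchanged since the residual of \<open>y\<close> is uncorrelated with \<open>z\<close>; the denominator can
  only grow when a regressor is dropped.\<close>

lemma avar_remove_le:
  assumes G: "maximal_pdag G" "D \<in> represented_dags G"
    and sets: "X \<subseteq> nodes G" "Y \<subseteq> nodes G" "X \<inter> Y = {}" "S \<subseteq> nodes G" "S \<inter> (X \<union> Y) = {}"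
    and model: "causal_linear_model_dag M \<mu> V f fdo D"
    and sep: "dsep G Y {z} (X \<union> (S - {z}))" and x: "x \<in> X" and y: "y \<in> Y"
  shows "avar M V X (S - {z}) y x \<le> avar M V X S y x"
proof (cases "z \<in> S")
  case True
  let ?N = "nodes G" and ?S = "cov_matrix M V" and ?W = "X \<union> (S - {z})"
  have D: "dag D" "nodes D = ?N"
    using G(2) by (auto simp: represented_dags_def)
  note cov = causal_linear_model_covariance[OF D(1) model, unfolded D(2)]
  obtain \<alpha> where \<alpha>: "\<And>k l. k \<in> ?N \<Longrightarrow> l \<in> ?N \<Longrightarrow> k \<noteq> l \<Longrightarrow>
      form ?N ?S (error_vector (dir D) \<alpha> k) (error_vector (dir D) \<alpha> l) = 0"
    using cov(2) by blast
  have pd: "positive_definite_on ?N ?S" by (rule cov(1))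
  have W: "?W \<subseteq> ?N" "insert z ?W = X \<union> S" "y \<in> ?N" "z \<in> ?N" "y \<notin> ?W" "z \<notin> ?W" "y \<notin> X \<union> S"
    using sets True x y by auto
  obtain R where R: "residual ?N ?S ?W y R"
    using residual_exists[OF pd W(1)] by blast
  have "walk_sep (dir D) {y} {z} ?W"
    using sep y dsep_iff_walk_sep[OF G sets(2)] by (auto simp: walk_sep_def)
  then have "form ?N ?S R (unit z) = 0"
    using walk_sep_imp_uncorrelated[OF pd dir_D_nodes[OF G] acyclic_dir_D[OF G] \<alpha>, of ?W y z R] W R
    by blast
  moreover have "insert z ?W \<subseteq> ?N" using W by blast
  ultimately have "partial_cov ?S (insert z ?W) y y = partial_cov ?S ?W y y"
    using partial_cov_insert_uncorrelated[OF pd _ W(3) R] by blast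
  then have num: "partial_cov ?S (X \<union> S) y y = partial_cov ?S ?W y y"
    unfolding W(2) .
  have num_pos: "0 < partial_cov ?S (X \<union> S) y y"
    using partial_cov_pos[OF pd, of "X \<union> S" y] sets W by blast
  let ?T = "X - {x} \<union> S"
  have T: "?T \<subseteq> ?N" "x \<in> ?N" "x \<notin> ?T" using sets x by auto
  have "partial_cov ?S ?T x x \<le> partial_cov ?S (X - {x} \<union> (S - {z})) x x"
    by (rule partial_cov_antimono[OF pd _ T(1,2)]) auto
  moreover have "0 < partial_cov ?S ?T x x"
    using partial_cov_pos[OF pd T] .
  ultimately show ?thesis
    unfolding avar_def num using num num_pos by (intro divide_left_mono) (auto intro: mult_pos_pos)
qed simp

section \<open>The pruned set\<close>

text \<open>The nodes that could be removed first. They turn out to be exactly those that pruning removes.\<close>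

definition redundant :: "'v pgraph \<Rightarrow> 'v set \<Rightarrow> 'v set \<Rightarrow> 'v set \<Rightarrow> 'v set" where
  "redundant G X Y Z = {z \<in> Z. dsep G Y {z} (X \<union> (Z - {z}))}"

context
  fixes G D :: "'v pgraph" and X Y Z :: "'v set"
  assumes G: "maximal_pdag G" "D \<in> represented_dags G" "Y \<subseteq> nodes G"
begin

text \<open>Intersection merges the separations of the single nodes.\<close>

lemma dsep_redundant: "dsep G Y (redundant G X Y Z) (X \<union> (Z - redundant G X Y Z))"
proof -
  let ?R = "redundant G X Y Z"
  have "\<exists>B\<subseteq>?R. z \<in> B \<and> walk_sep (dir D) Y B (X \<union> (Z - ?R) \<union> (?R - B))" if "z \<in> ?R" for z
  proof -
    have "X \<union> (Z - ?R) \<union> (?R - {z}) = X \<union> (Z - {z})"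
      using that by (auto simp: redundant_def)
    with that show ?thesis
      by (intro exI[of _ "{z}"]) (auto simp: redundant_def dsep_iff_walk_sep[OF G])
  qed
  then show ?thesis
    unfolding dsep_iff_walk_sep[OF G] by (rule walk_sep_intersection)
qed

text \<open>By weak union from the separation of the whole set of redundant nodes.\<close>

lemma redundant_remains_redundant:
  assumes "Q \<subseteq> redundant G X Y Z" "z \<in> redundant G X Y Z"
  shows "dsep G Y {z} (X \<union> (Z - Q - {z}))"
proof -
  let ?R = "redundant G X Y Z"
  have "walk_sep (dir D) Y ({z} \<union> (?R - Q - {z})) (X \<union> (Z - ?R))"
    using dsep_redundant assms(2) walk_sep_mono unfolding dsep_iff_walk_sep[OF G]
    by (metis Diff_subset Un_least empty_subsetI insert_subset order_trans)
  then have "walk_sep (dir D) Y {z} (X \<union> (Z - ?R) \<union> (?R - Q - {z}))"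
    by (rule walk_sep_weak_union[OF acyclic_dir_D[OF G(1,2)]])
  moreover have "X \<union> (Z - ?R) \<union> (?R - Q - {z}) = X \<union> (Z - Q - {z})"
    using assms by (auto simp: redundant_def)
  ultimately show ?thesis
    unfolding dsep_iff_walk_sep[OF G] by simp
qed

text \<open>Contraction of a separation of \<open>z\<close> with that of the nodes \<open>Q\<close> already removed would show that \<open>z\<close>
  is redundant in \<open>Z\<close>.\<close>

lemma irredundant_remains_irredundant:
  assumes Q: "Q \<subseteq> redundant G X Y Z" and z: "z \<in> Z" "z \<notin> redundant G X Y Z"
  shows "\<not> dsep G Y {z} (X \<union> (Z - Q - {z}))"
proof
  let ?R = "redundant G X Y Z"
  note acyc = acyclic_dir_D[OF G(1,2)]
  have QZ: "Q \<subseteq> Z" using Q by (auto simp: redundant_def)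
  assume "dsep G Y {z} (X \<union> (Z - Q - {z}))"
  then have sep_z: "walk_sep (dir D) Y {z} (X \<union> (Z - Q - {z}))"
    using dsep_iff_walk_sep[OF G] by blast
  have "Q \<union> (?R - Q) = ?R" using Q by blast
  then have "walk_sep (dir D) Y (Q \<union> (?R - Q)) (X \<union> (Z - ?R))"
    using dsep_redundant dsep_iff_walk_sep[OF G] by simp
  then have "walk_sep (dir D) Y Q (X \<union> (Z - ?R) \<union> (?R - Q))"
    by (rule walk_sep_weak_union[OF acyc])
  moreover have "X \<union> (Z - ?R) \<union> (?R - Q) = X \<union> (Z - Q - {z}) \<union> {z}"
    using Q z by (auto simp: redundant_def)
  ultimately have "walk_sep (dir D) Y (Q \<union> {z}) (X \<union> (Z - Q - {z}))"
    using walk_sep_contraction sep_z by metis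
  then have "walk_sep (dir D) Y ({z} \<union> Q) (X \<union> (Z - Q - {z}))"
    by (simp add: Un_commute)
  then have "walk_sep (dir D) Y {z} (X \<union> (Z - Q - {z}) \<union> Q)"
    by (rule walk_sep_weak_union[OF acyc])
  moreover have "X \<union> (Z - Q - {z}) \<union> Q = X \<union> (Z - {z})"
    using Q z QZ by blast
  ultimately show False
    using z dsep_iff_walk_sep[OF G] by (simp add: redundant_def)
qed

lemma prune_removes_redundant:
  "set zs \<subseteq> Z \<Longrightarrow> prune G X Y Z zs = Z - (redundant G X Y Z \<inter> set zs)"
proof (induction zs rule: rev_induct)
  case (snoc z zs)
  let ?R = "redundant G X Y Z"
  let ?Q = "?R \<inter> set zs"
  have "prune G X Y Z (zs @ [z]) = prune_step G X Y (Z - ?Q) z"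
    using snoc by (simp add: prune_def)
  also have "\<dots> = Z - (?R \<inter> set (zs @ [z]))"
  proof (cases "z \<in> ?R")
    case True
    then have "dsep G Y {z} (X \<union> (Z - ?Q - {z}))"
      by (intro redundant_remains_redundant) auto
    with True show ?thesis by (auto simp: prune_step_def)
  next
    case False
    then have "\<not> dsep G Y {z} (X \<union> (Z - ?Q - {z}))"
      using snoc.prems by (intro irredundant_remains_irredundant) auto
    with False show ?thesis by (auto simp: prune_step_def)
  qed
  finally show ?case .
qed (simp add: prune_def)

text \<open>The nodes in which the two sets differ are jointly separated from \<open>Y\<close> given the common ones, by
  intersection. So each node of the pruned set outside \<open>Z''\<close> would have been removable, and there is
  none.\<close>

lemma criterion_cannot_improve:
  assumes Z'': "Z'' \<subseteq> Z" and crit: "criterion_applies G X Y (Z - redundant G X Y Z) Z''"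
  shows "criterion_applies G X Y Z'' (Z - redundant G X Y Z)"
proof -
  let ?R = "redundant G X Y Z"
  let ?Z' = "Z - ?R"
  let ?P = "?Z' - Z''" and ?Q = "Z'' - ?Z'" and ?W = "X \<union> (?Z' \<inter> Z'')"
  note acyc = acyclic_dir_D[OF G(1,2)]
  have sep_P: "walk_sep (dir D) Y ?P (X \<union> Z'')"
    using crit dsep_iff_walk_sep[OF G] by (simp add: criterion_applies_def)
  have "walk_sep (dir D) Y ?R (X \<union> ?Z')"
    using dsep_redundant dsep_iff_walk_sep[OF G] by blast
  moreover have "?Q \<subseteq> ?R" using Z'' by blast
  ultimately have sep_Q: "walk_sep (dir D) Y ?Q (X \<union> ?Z')"
    by (rule walk_sep_mono)
  have PQ: "?W \<union> ((?P \<union> ?Q) - ?P) = X \<union> Z''" "?W \<union> ((?P \<union> ?Q) - ?Q) = X \<union> ?Z'"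
    by blast+
  have sep_PQ: "walk_sep (dir D) Y (?P \<union> ?Q) ?W"
  proof (rule walk_sep_intersection)
    fix v assume "v \<in> ?P \<union> ?Q"
    then show "\<exists>B\<subseteq>?P \<union> ?Q. v \<in> B \<and> walk_sep (dir D) Y B (?W \<union> ((?P \<union> ?Q) - B))"
    proof
      assume "v \<in> ?P"
      then show ?thesis using sep_P PQ(1) by (intro exI[of _ ?P]) simp
    next
      assume "v \<in> ?Q"
      then show ?thesis using sep_Q PQ(2) by (intro exI[of _ ?Q]) simp
    qed
  qed
  have "?P = {}"
  proof (rule ccontr)
    assume "?P \<noteq> {}"
    then obtain z where z: "z \<in> Z" "z \<notin> ?R" "z \<notin> Z''" by blast
    then have "walk_sep (dir D) Y ({z} \<union> (?P - {z})) ?W"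
      by (intro walk_sep_mono[OF sep_PQ]) auto
    then have "walk_sep (dir D) Y {z} (?W \<union> (?P - {z}))"
      by (rule walk_sep_weak_union[OF acyc])
    moreover have "?W \<union> (?P - {z}) = X \<union> (?Z' - {z})"
      using z by blast
    ultimately show False
      using irredundant_remains_irredundant[OF subset_refl z(1,2)] dsep_iff_walk_sep[OF G] by simp
  qed
  then have "dsep G X ?P Z''"
    by (simp only:) (simp add: dsep_def path_from_to_def)
  with crit sep_Q show ?thesis
    by (simp add: criterion_applies_def dsep_iff_walk_sep[OF G])
qed

end

theorem theorem3p9:
  fixes G :: "'v pgraph" and X Y Z :: "'v set" and zs :: "'v list"
    and M :: "'w measure" and \<mu> :: "'v \<Rightarrow> real measure"
    and V :: "'v \<Rightarrow> 'w \<Rightarrow> real" and f :: "('v \<Rightarrow> real) \<Rightarrow> ennreal"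
    and fdo :: "'v set \<Rightarrow> ('v \<Rightarrow> real) \<Rightarrow> ('v \<Rightarrow> real) \<Rightarrow> ennreal"
  assumes "maximal_pdag G"
    and "X \<subseteq> nodes G" and "Y \<subseteq> nodes G" and "X \<inter> Y = {}"
    and "causal_linear_model M \<mu> V f fdo G"
    and "valid_adjustment_set G X Y Z"
    and "distinct zs" and "set zs = Z"
  shows "(prune G X Y Z zs \<subseteq> Z
          \<and> valid_adjustment_set G X Y (prune G X Y Z zs)
          \<and> (\<forall>y\<in>Y. \<forall>x\<in>X. avar M V X (prune G X Y Z zs) y x \<le> avar M V X Z y x))
       \<and> \<not> (\<exists>Z''\<subseteq>Z. valid_adjustment_set G X Y Z''
              \<and> criterion_applies G X Y (prune G X Y Z zs) Z''
              \<and> \<not> criterion_applies G X Y Z'' (prune G X Y Z zs))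
       \<and> (\<forall>zs'. distinct zs' \<and> set zs' = Z \<longrightarrow> prune G X Y Z zs' = prune G X Y Z zs)"
proof -
  obtain D where D: "D \<in> represented_dags G" and model: "causal_linear_model_dag M \<mu> V f fdo D"
    using assms(5) by (auto simp: causal_linear_model_def)
  note G = assms(1) D assms(3)
  have prune_eq: "prune G X Y Z zs' = Z - redundant G X Y Z" if "set zs' = Z" for zs'
    using prune_removes_redundant[OF G, of zs' Z X] that by (auto simp: redundant_def)
  have "valid_adjustment_set G X Y (prune G X Y Z zs')
      \<and> (\<forall>y\<in>Y. \<forall>x\<in>X. avar M V X (prune G X Y Z zs') y x \<le> avar M V X Z y x)" for zs'
  proof (induction zs' rule: rev_induct)
    case Nil
    then show ?case using assms(6) by (simp add: prune_def)
  next
    case (snoc z zs')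
    define S where "S = prune G X Y Z zs'"
    have S: "valid_adjustment_set G X Y S"
      "\<And>x y. x \<in> X \<Longrightarrow> y \<in> Y \<Longrightarrow> avar M V X S y x \<le> avar M V X Z y x"
      using snoc.IH by (auto simp: S_def)
    have step: "prune G X Y Z (zs' @ [z]) = prune_step G X Y S z"
      by (simp add: prune_def S_def)
    show ?case
    proof (cases "dsep G Y {z} (X \<union> (S - {z}))")
      case True
      have "avar M V X (S - {z}) y x \<le> avar M V X S y x" if "x \<in> X" "y \<in> Y" for x y
        by (rule avar_remove_le[OF assms(1) D assms(2,3,4) _ _ model True that])
          (use S(1) in \<open>auto simp: valid_adjustment_set_def\<close>)
      then have "avar M V X (S - {z}) y x \<le> avar M V X Z y x" if "x \<in> X" "y \<in> Y" for x y
        using S(2) that order_trans by blast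
      with True valid_adjustment_set_remove[OF G S(1) True] show ?thesis
        unfolding step by (simp add: prune_step_def)
    next
      case False
      with S show ?thesis unfolding step by (simp add: prune_step_def)
    qed
  qed
  from this[of zs]
  have "valid_adjustment_set G X Y (Z - redundant G X Y Z)"
    "\<forall>y\<in>Y. \<forall>x\<in>X. avar M V X (Z - redundant G X Y Z) y x \<le> avar M V X Z y x"
    unfolding prune_eq[OF assms(8)] by blast+
  moreover have "criterion_applies G X Y Z'' (Z - redundant G X Y Z)"
    if "Z'' \<subseteq> Z" "criterion_applies G X Y (Z - redundant G X Y Z) Z''" for Z''
    using criterion_cannot_improve[OF G that] .
  ultimately show ?thesis
    unfolding prune_eq[OF assms(8)] using prune_eq by simp
qed

end
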